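(* Let $H\in\{\text{house},\text{hammer}\}$, let $\mathcal{C}$ be the class of $(\text{bull},H)$-free graphs, let $\mathcal{G}$ be a hereditary class of graphs, and let $\mathcal{H}$ be the class of triangle-free graphs. Then every graph in $\mathcal{G}\cap\mathcal{C}$ is perfectly weight divisible if and only if every graph in $\mathcal{G}\cap\mathcal{H}$ is perfectly weight divisible.
   Context: Graphs are finite and simple. A bull is a triangle with two disjoint pendant edges. A house is the complement of $P_5$. A hammer is obtained by identifying an end vertex of a $P_3$ with a vertex of a triangle. A class is hereditary if closed under isomorphism and induced subgraphs. A graph is perfect if $\chi(H)=\omega(H)$ for all induced subgraphs $H$. For a weight function $w$, $\omega_w$ denotes the maximum weight of a clique. $G$ is perfectly weight divisible if for every positive integer weight function $w$ on $V(G)$ and every induced subgraph $H'$ of $G$, there is a partition of $V(H')$ into $P,W$ with $H'[P]$ perfect and $\omega_w(H'[W])<\omega_w(H')$. *)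

theory Defs
  imports "Graph_Theory.Graph_Theory"
begin

text \<open>
  A finite simple graph is a \<^term>\<open>G :: 'a pair_pre_digraph\<close> with \<^term>\<open>pair_graph G\<close>: finitely many
  vertices, no loops, and an edge uv is the pair of arcs (u,v), (v,u). The null graph is allowed.
\<close>

definition clique :: "('a, 'b) pre_digraph \<Rightarrow> 'a set \<Rightarrow> bool" where
  "clique G K \<longleftrightarrow> K \<subseteq> verts G \<and> (\<forall>u\<in>K. \<forall>v\<in>K. u \<noteq> v \<longrightarrow> u \<rightarrow>\<^bsub>G\<^esub> v)"

definition clique_number :: "('a, 'b) pre_digraph \<Rightarrow> nat" where
  "clique_number G = Max (card ` {K. clique G K})"

text \<open>The empty set is a clique, so the value on the null graph is 0.\<close>

definition weighted_clique_number :: "('a \<Rightarrow> nat) \<Rightarrow> ('a, 'b) pre_digraph \<Rightarrow> nat" where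
  "weighted_clique_number w G = Max (sum w ` {K. clique G K})"

definition proper_coloring :: "('a, 'b) pre_digraph \<Rightarrow> nat \<Rightarrow> ('a \<Rightarrow> nat) \<Rightarrow> bool" where
  "proper_coloring G k c \<longleftrightarrow>
     (\<forall>v\<in>verts G. c v < k) \<and> (\<forall>u\<in>verts G. \<forall>v\<in>verts G. u \<rightarrow>\<^bsub>G\<^esub> v \<longrightarrow> c u \<noteq> c v)"

definition chromatic_number :: "('a, 'b) pre_digraph \<Rightarrow> nat" where
  "chromatic_number G = (LEAST k. \<exists>c. proper_coloring G k c)"

definition perfect :: "('a, 'b) pre_digraph \<Rightarrow> bool" where
  "perfect G \<longleftrightarrow> (\<forall>H. induced_subgraph H G \<longrightarrow> chromatic_number H = clique_number H)"

text \<open>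
  The induced subgraph \<^term>\<open>H\<close> must be non-null: for the null graph the strict inequality 0 < 0 fails,
  so no graph would satisfy the condition. Either part of the partition may be empty.
\<close>

definition perfectly_weight_divisible :: "('a, 'b) pre_digraph \<Rightarrow> bool" where
  "perfectly_weight_divisible G \<longleftrightarrow>
     (\<forall>w :: 'a \<Rightarrow> nat. (\<forall>v\<in>verts G. 0 < w v) \<longrightarrow>
       (\<forall>H. induced_subgraph H G \<and> verts H \<noteq> {} \<longrightarrow>
         (\<exists>P W. P \<union> W = verts H \<and> P \<inter> W = {} \<and> perfect (H \<restriction> P) \<and>
                weighted_clique_number w (H \<restriction> W) < weighted_clique_number w H)))"

definition hereditary :: "'a pair_pre_digraph set \<Rightarrow> bool" where
  "hereditary \<G> \<longleftrightarrow>
     (\<forall>G\<in>\<G>. pair_graph G) \<and>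
     (\<forall>G\<in>\<G>. \<forall>H. digraph_iso (with_proj G) (with_proj H) \<longrightarrow> H \<in> \<G>) \<and>
     (\<forall>G\<in>\<G>. \<forall>H. induced_subgraph (with_proj H) (with_proj G) \<longrightarrow> H \<in> \<G>)"

definition contains_induced :: "('a, 'b) pre_digraph \<Rightarrow> ('c, 'd) pre_digraph \<Rightarrow> bool" where
  "contains_induced G F \<longleftrightarrow> (\<exists>S. induced_subgraph S G \<and> digraph_iso F S)"

definition free_graphs :: "'c pair_pre_digraph set \<Rightarrow> 'a pair_pre_digraph set" where
  "free_graphs \<F> =
     {G. pair_graph G \<and> (\<forall>F\<in>\<F>. \<not> contains_induced (with_proj G) (with_proj F))}"

definition graph_of_edges :: "nat \<Rightarrow> (nat \<times> nat) set \<Rightarrow> nat pair_pre_digraph" where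
  "graph_of_edges n E = \<lparr>pverts = {..<n}, parcs = E \<union> E\<inverse>\<rparr>"

definition path_graph :: "nat \<Rightarrow> nat pair_pre_digraph" where
  "path_graph n = graph_of_edges n {(i, Suc i) | i. Suc i < n}"

definition complement_graph :: "'a pair_pre_digraph \<Rightarrow> 'a pair_pre_digraph" where
  "complement_graph G = \<lparr>pverts = pverts G,
     parcs = {(u, v). u \<in> pverts G \<and> v \<in> pverts G \<and> u \<noteq> v \<and> (u, v) \<notin> parcs G}\<rparr>"

definition triangle_graph :: "nat pair_pre_digraph" where
  "triangle_graph = graph_of_edges 3 {(0, 1), (1, 2), (0, 2)}"

text \<open>The triangle 0, 1, 2 with the pendant edges 03 and 14.\<close>

definition bull :: "nat pair_pre_digraph" where
  "bull = graph_of_edges 5 {(0, 1), (1, 2), (0, 2), (0, 3), (1, 4)}"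

definition house :: "nat pair_pre_digraph" where
  "house = complement_graph (path_graph 5)"

text \<open>The triangle 0, 1, 2 and the path 2, 3, 4 on three vertices, sharing vertex 2.\<close>

definition hammer :: "nat pair_pre_digraph" where
  "hammer = graph_of_edges 5 {(0, 1), (1, 2), (0, 2), (2, 3), (3, 4)}"

end

theory Submission
  imports Defs
begin

text \<open>
  Triangle-free graphs are bull-, house- and hammer-free, so only one direction needs work. Take a
  minimal counterexample \<open>U\<close> (with a weight \<open>w\<close>); it contains a triangle. A homogeneous set could be
  contracted to a single vertex carrying its weighted clique number, and Lovasz's substitution lemma
  would turn the partitions of the smaller graphs into one of \<open>U\<close>; hence \<open>U\<close> is prime. For every
  vertex \<open>v\<close> the non-neighbourhood of \<open>v\<close> is imperfect, since otherwise it could serve as \<open>P\<close> and the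
  neighbourhood as \<open>W\<close>. So every \<open>v\<close> is anticomplete to a minimal imperfect set \<open>C\<close>, and all that is
  needed about \<open>C\<close> is that it is prime, not a split graph, and has no two non-adjacent vertices with
  nested neighbourhoods; in particular no form of the strong perfect graph theorem enters.

  Choose \<open>v\<close> in a triangle. Since \<open>U\<close> is prime and bull-free, \<open>C\<close> has no centre (vertex complete to
  \<open>C\<close>). Let \<open>B\<close> be the vertices outside \<open>C\<close> anticomplete to \<open>C\<close> and \<open>R\<close> the remaining ones. The absence of
  houses or of hammers moves the triangle until it meets both \<open>B\<close> and \<open>R\<close>, and such a triangle yields
  a forbidden subgraph.
\<close>

section \<open>Bull-free prime graphs\<close>

locale simple_graph =
  fixes adj :: "'a \<Rightarrow> 'a \<Rightarrow> bool"
  assumes adj_sym: "adj u v \<Longrightarrow> adj v u"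
    and adj_irrefl [simp]: "\<not> adj u u"
begin

lemma adj_commute: "adj u v \<longleftrightarrow> adj v u"
  using adj_sym by blast

definition is_clique :: "'a set \<Rightarrow> bool" where
  "is_clique K \<longleftrightarrow> (\<forall>u\<in>K. \<forall>v\<in>K. u \<noteq> v \<longrightarrow> adj u v)"

definition is_stable :: "'a set \<Rightarrow> bool" where
  "is_stable S \<longleftrightarrow> (\<forall>u\<in>S. \<forall>v\<in>S. \<not> adj u v)"

definition split :: "'a set \<Rightarrow> bool" where
  "split U \<longleftrightarrow> (\<exists>K S. U = K \<union> S \<and> is_clique K \<and> is_stable S)"

text \<open>Primeness in the sense of modular decomposition: \<open>X\<close> is a candidate for a
  nontrivial homogeneous set, and \<open>w\<close> distinguishes two of its members.\<close>

definition prime_on :: "'a set \<Rightarrow> bool" where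
  "prime_on U \<longleftrightarrow> (\<forall>X. X \<subset> U \<longrightarrow> (\<exists>p\<in>X. \<exists>q\<in>X. p \<noteq> q) \<longrightarrow>
     (\<exists>w\<in>U - X. \<exists>p\<in>X. \<exists>q\<in>X. adj w p \<and> \<not> adj w q))"

definition no_domination :: "'a set \<Rightarrow> bool" where
  "no_domination C \<longleftrightarrow>
     (\<forall>s\<in>C. \<forall>y\<in>C. s \<noteq> y \<and> \<not> adj s y \<longrightarrow> (\<exists>t\<in>C. adj s t \<and> \<not> adj y t))"

text \<open>Triangle \<open>a\<close>, \<open>b\<close>, \<open>c\<close> with pendants
  \<open>d\<close> at \<open>a\<close> and \<open>e\<close> at \<open>b\<close>; instances of
  \<open>bullI\<close> list the vertices in this order. Here and in the next two patterns the
  prescribed adjacencies and non-adjacencies force the five vertices to be distinct.\<close>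

definition bull_in :: "'a set \<Rightarrow> bool" where
  "bull_in U \<longleftrightarrow> (\<exists>a\<in>U. \<exists>b\<in>U. \<exists>c\<in>U. \<exists>d\<in>U. \<exists>e\<in>U.
     adj a b \<and> adj b c \<and> adj a c \<and> adj a d \<and> adj b e \<and>
     \<not> adj b d \<and> \<not> adj c d \<and> \<not> adj a e \<and> \<not> adj c e \<and> \<not> adj d e)"

text \<open>\<open>r\<close> is the roof over the four-cycle \<open>a\<close>, \<open>b\<close>,
  \<open>d\<close>, \<open>c\<close>.\<close>

definition house_in :: "'a set \<Rightarrow> bool" where
  "house_in U \<longleftrightarrow> (\<exists>r\<in>U. \<exists>a\<in>U. \<exists>b\<in>U. \<exists>c\<in>U. \<exists>d\<in>U.
     adj r a \<and> adj r b \<and> adj a b \<and> adj a c \<and> adj b d \<and> adj c d \<and>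
     \<not> adj r c \<and> \<not> adj r d \<and> \<not> adj a d \<and> \<not> adj b c)"

definition hammer_in :: "'a set \<Rightarrow> bool" where
  "hammer_in U \<longleftrightarrow> (\<exists>a\<in>U. \<exists>b\<in>U. \<exists>c\<in>U. \<exists>d\<in>U. \<exists>e\<in>U.
     adj a b \<and> adj b c \<and> adj a c \<and> adj c d \<and> adj d e \<and>
     \<not> adj a d \<and> \<not> adj b d \<and> \<not> adj a e \<and> \<not> adj b e \<and> \<not> adj c e)"

lemma bullI:
  assumes "adj a b" "adj b c" "adj a c" "adj a d" "adj b e"
    and "\<not> adj b d" "\<not> adj c d" "\<not> adj a e" "\<not> adj c e" "\<not> adj d e"
    and "a \<in> U" "b \<in> U" "c \<in> U" "d \<in> U" "e \<in> U"
  shows "bull_in U"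
  unfolding bull_in_def using assms by blast

lemma houseI:
  assumes "adj r a" "adj r b" "adj a b" "adj a c" "adj b d" "adj c d"
    and "\<not> adj r c" "\<not> adj r d" "\<not> adj a d" "\<not> adj b c"
    and "r \<in> U" "a \<in> U" "b \<in> U" "c \<in> U" "d \<in> U"
  shows "house_in U"
  unfolding house_in_def using assms by blast

lemma hammerI:
  assumes "adj a b" "adj b c" "adj a c" "adj c d" "adj d e"
    and "\<not> adj a d" "\<not> adj b d" "\<not> adj a e" "\<not> adj b e" "\<not> adj c e"
    and "a \<in> U" "b \<in> U" "c \<in> U" "d \<in> U" "e \<in> U"
  shows "hammer_in U"
  unfolding hammer_in_def using assms by blast

lemma split_subset:
  assumes "split U" "C \<subseteq> U"
  shows "split C"
proof -
  obtain K S where "U = K \<union> S" "is_clique K" "is_stable S"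
    using assms(1) unfolding split_def by blast
  then have "C = (K \<inter> C) \<union> (S \<inter> C)" "is_clique (K \<inter> C)" "is_stable (S \<inter> C)"
    using assms(2) by (auto simp: is_clique_def is_stable_def)
  then show ?thesis unfolding split_def by blast
qed

text \<open>The connected component of the edge \<open>pq\<close> in \<open>N\<close> is not homogeneous, which yields \<open>w\<close>.\<close>
lemma prime_edge:
  assumes "prime_on U" "N \<subseteq> U" "N \<noteq> U" "p \<in> N" "q \<in> N" "adj p q"
  obtains p' q' w where "p' \<in> N" "q' \<in> N" "w \<in> U" "w \<notin> N" "adj p' q'" "adj w p'" "\<not> adj w q'"
proof -
  define r where "r = {(a, b). a \<in> N \<and> b \<in> N \<and> adj a b}"
  define Z where "Z = {z. (p, z) \<in> r\<^sup>*}"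
  have ZN: "z \<in> N" if "z \<in> Z" for z
  proof -
    have "(p, z) \<in> r\<^sup>*" using that Z_def by simp
    then show ?thesis by (induction rule: rtrancl_induct) (auto simp: r_def assms)
  qed
  have "(p, q) \<in> r" "p \<noteq> q" using assms by (auto simp: r_def)
  then have "p \<in> Z" "q \<in> Z" "p \<noteq> q" "Z \<subset> U"
    using assms(2,3) ZN unfolding Z_def by blast+
  then obtain w z1 z2 where w: "w \<in> U" "w \<notin> Z" "z1 \<in> Z" "z2 \<in> Z" "adj w z1" "\<not> adj w z2"
    using assms(1)[unfolded prime_on_def, rule_format, of Z] by (metis Diff_iff)
  have wN: "w \<notin> N"
  proof
    assume "w \<in> N"
    moreover have "z1 \<in> N" "adj z1 w" using ZN w(3,5) adj_sym by blast+
    ultimately have "(z1, w) \<in> r" by (simp add: r_def)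
    then have "w \<in> Z" using w(3) unfolding Z_def by (blast intro: rtrancl_into_rtrancl)
    then show False using w by blast
  qed
  \<comment> \<open>If \<open>w\<close> distinguished the ends of no edge in \<open>r\<close>,
    adjacency to \<open>w\<close> would be constant along paths from \<open>p\<close>, against
    \<open>z1\<close> and \<open>z2\<close>.\<close>
  have "\<exists>a b. (a, b) \<in> r \<and> adj w a \<and> \<not> adj w b"
  proof (rule ccontr)
    assume no: "\<not> ?thesis"
    have rs: "(b, a) \<in> r" if "(a, b) \<in> r" for a b using that by (auto simp: r_def adj_commute)
    have "adj w z \<longleftrightarrow> adj w p" if "z \<in> Z" for z
    proof -
      have "(p, z) \<in> r\<^sup>*" using that Z_def by simp
      then show ?thesis by (induction rule: rtrancl_induct) (use no rs in blast)+
    qed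
    then show False using w by blast
  qed
  then show thesis using that w(1) wN unfolding r_def by blast
qed

text \<open>With no crossing edge, \<open>X\<close> and \<open>U - X\<close> would both be
  homogeneous, hence singletons by primeness, and two non-adjacent vertices form a split
  graph.\<close>

lemma cut_edge:
  assumes "prime_on U" "\<not> split U" "X \<subseteq> U" "X \<noteq> {}" "X \<noteq> U"
  obtains x y where "x \<in> X" "y \<in> U - X" "adj x y"
proof (rule ccontr)
  assume "\<not> thesis"
  then have no: "\<not> adj x y \<and> \<not> adj y x" if "x \<in> X" "y \<in> U - X" for x y
    using that \<open>\<And>x y. \<lbrakk>x \<in> X; y \<in> U - X; adj x y\<rbrakk> \<Longrightarrow> thesis\<close> adj_sym by blast
  obtain x y where xy: "x \<in> X" "y \<in> U - X" using assms by blast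
  have "z = x" if "z \<in> X" for z
    using assms(1)[unfolded prime_on_def, rule_format, of X] assms(3,5) xy that no by blast
  moreover have "z = y" if "z \<in> U - X" for z
    using assms(1)[unfolded prime_on_def, rule_format, of "U - X"] assms(3,4) xy that no by blast
  ultimately have "U = {x} \<union> {y}" using assms(3) xy by blast
  moreover have "is_clique {x}" "is_stable {y}" by (auto simp: is_clique_def is_stable_def)
  ultimately show False using assms(2) unfolding split_def by blast
qed

section \<open>Passage to the complement\<close>

lemma complement_simple_graph: "simple_graph (\<lambda>u v. u \<noteq> v \<and> \<not> adj u v)"
  by unfold_locales (auto simp: adj_commute)

lemma prime_on_complement:
  assumes "prime_on U"
  shows "simple_graph.prime_on (\<lambda>u v. u \<noteq> v \<and> \<not> adj u v) U"
proof -
  interpret co: simple_graph "\<lambda>u v. u \<noteq> v \<and> \<not> adj u v" by (rule complement_simple_graph)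
  show ?thesis
    unfolding co.prime_on_def
  proof (intro allI impI)
    fix X assume "X \<subset> U" "\<exists>p\<in>X. \<exists>q\<in>X. p \<noteq> q"
    then obtain w p q where "w \<in> U - X" "p \<in> X" "q \<in> X" "adj w p" "\<not> adj w q"
      using assms unfolding prime_on_def by meson
    then show "\<exists>w\<in>U - X. \<exists>p\<in>X. \<exists>q\<in>X. (w \<noteq> p \<and> \<not> adj w p) \<and> \<not> (w \<noteq> q \<and> \<not> adj w q)"
      by (intro bexI[of _ w] bexI[of _ q] bexI[of _ p]) auto
  qed
qed

lemma split_complement:
  assumes "simple_graph.split (\<lambda>u v. u \<noteq> v \<and> \<not> adj u v) U"
  shows "split U"
proof -
  interpret co: simple_graph "\<lambda>u v. u \<noteq> v \<and> \<not> adj u v" by (rule complement_simple_graph)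
  obtain K S where "U = K \<union> S" and K: "co.is_clique K" and S: "co.is_stable S"
    using assms unfolding co.split_def by blast
  have "\<not> adj u v" if "u \<in> K" "v \<in> K" for u v
    using K that unfolding co.is_clique_def by (cases "u = v") auto
  then have "is_stable K" unfolding is_stable_def by blast
  moreover have "is_clique S"
    using S unfolding co.is_stable_def is_clique_def by blast
  ultimately show ?thesis using \<open>U = K \<union> S\<close> unfolding split_def by blast
qed

text \<open>The bull is self-complementary: \<open>c\<close> with the old pendants \<open>d\<close>,
  \<open>e\<close> becomes the triangle, and \<open>a\<close>, \<open>b\<close> become the
  pendants.\<close>

lemma bull_in_complement:
  assumes "simple_graph.bull_in (\<lambda>u v. u \<noteq> v \<and> \<not> adj u v) U"
  shows "bull_in U"
proof -
  interpret co: simple_graph "\<lambda>u v. u \<noteq> v \<and> \<not> adj u v" by (rule complement_simple_graph)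
  obtain a b c d e where *: "a\<in>U" "b\<in>U" "c\<in>U" "d\<in>U" "e\<in>U"
     "a \<noteq> b \<and> \<not> adj a b" "b \<noteq> c \<and> \<not> adj b c" "a \<noteq> c \<and> \<not> adj a c" "a \<noteq> d \<and> \<not> adj a d"
     "b \<noteq> e \<and> \<not> adj b e"
     "\<not> (b \<noteq> d \<and> \<not> adj b d)" "\<not> (c \<noteq> d \<and> \<not> adj c d)" "\<not> (a \<noteq> e \<and> \<not> adj a e)"
     "\<not> (c \<noteq> e \<and> \<not> adj c e)" "\<not> (d \<noteq> e \<and> \<not> adj d e)"
    using assms unfolding co.bull_in_def by blast
  \<comment> \<open>A failed adjacency in the complement means equality or adjacency under
    \<open>adj\<close>; excluding equality leaves adjacency.\<close>
  have ne: "b \<noteq> d" "c \<noteq> d" "a \<noteq> e" "c \<noteq> e" "d \<noteq> e"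
    using *(6-15) by (auto dest: adj_sym)
  show ?thesis using * ne by (intro bullI[of e d c a b]) (auto simp: adj_commute)
qed

text \<open>An edge inside the neighbourhood of \<open>y\<close> in \<open>C\<close> would give, by
  \<open>prime_edge\<close>, an edge \<open>p' q'\<close> there and a vertex \<open>r\<close> of
  \<open>C\<close> seeing \<open>p'\<close> only; the triangle \<open>y\<close>, \<open>p'\<close>,
  \<open>q'\<close> with pendants \<open>b\<close> and \<open>r\<close> is a bull.\<close>

lemma neighbours_stable:
  assumes "prime_on C" "C \<subseteq> U" "\<not> bull_in U"
    and "y \<in> U" "b \<in> U" "adj y b" "\<forall>c\<in>C. \<not> adj b c" "\<exists>c\<in>C. \<not> adj y c"
  shows "is_stable {c\<in>C. adj y c}"
proof (rule ccontr)
  assume "\<not> ?thesis"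
  then obtain p q where pq: "p \<in> {c\<in>C. adj y c}" "q \<in> {c\<in>C. adj y c}" "adj p q"
    unfolding is_stable_def by blast
  obtain p' q' r where "p' \<in> {c\<in>C. adj y c}" "q' \<in> {c\<in>C. adj y c}" "r \<in> C"
      "r \<notin> {c\<in>C. adj y c}" "adj p' q'" "adj r p'" "\<not> adj r q'"
    by (rule prime_edge[OF assms(1) _ _ pq]) (use assms(8) in auto)
  then have "bull_in U" using assms
    by (intro bullI[of y p' q' b r]) (auto simp: adj_commute)
  then show False using assms by blast
qed

text \<open>Otherwise \<open>N(y) \<inter> C\<close> is stable and, dually, \<open>C - N(y)\<close> is a clique, so \<open>C\<close> is split.\<close>
lemma center_or_anticenter:
  assumes "prime_on C" "\<not> split C" "C \<subseteq> U" "\<not> bull_in U"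
    and "y \<in> U" "a \<in> U" "b \<in> U" "y \<notin> C" "\<exists>c\<in>C. \<not> adj y c" "\<exists>c\<in>C. adj y c"
    and "\<forall>c\<in>C. adj a c" "\<forall>c\<in>C. \<not> adj b c" "adj y b"
  shows "adj y a"
proof (rule ccontr)
  assume na: "\<not> adj y a"
  interpret co: simple_graph "\<lambda>u v. u \<noteq> v \<and> \<not> adj u v" by (rule complement_simple_graph)
  have "is_stable {c\<in>C. adj y c}"
    using neighbours_stable assms by blast
  moreover have "co.is_stable {c\<in>C. y \<noteq> c \<and> \<not> adj y c}"
    by (rule co.neighbours_stable[of C U y a])
      (use assms na bull_in_complement prime_on_complement in auto)
  then have "is_clique {c\<in>C. \<not> adj y c}"
    using assms(8) unfolding co.is_stable_def is_clique_def by auto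
  ultimately have "split C" unfolding split_def
    by (intro exI[of _ "{c\<in>C. \<not> adj y c}"] exI[of _ "{c\<in>C. adj y c}"]) auto
  then show False using assms by blast
qed

text \<open>An edge \<open>p q\<close> of \<open>C\<close> leaving the neighbourhood of
  \<open>y\<close> forms a triangle with the centre \<open>a\<close>; if \<open>y\<close> missed
  \<open>b\<close>, then \<open>y\<close> at \<open>p\<close> and \<open>b\<close> at
  \<open>a\<close> would complete a bull.\<close>

lemma anticenter_propagates:
  assumes "prime_on C" "C \<subseteq> U" "\<not> bull_in U"
    and "y \<in> U" "a \<in> U" "b \<in> U" "\<exists>c\<in>C. \<not> adj y c" "\<exists>c\<in>C. adj y c" "\<not> split C"
    and "\<forall>c\<in>C. adj a c" "\<forall>c\<in>C. \<not> adj b c" "\<not> adj y a" "adj a b"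
  shows "adj y b"
proof (rule ccontr)
  assume nb: "\<not> adj y b"
  obtain p q where "p \<in> {c\<in>C. adj y c}" "q \<in> C - {c\<in>C. adj y c}" "adj p q"
    by (rule cut_edge[of C "{c\<in>C. adj y c}"]) (use assms in auto)
  then have "bull_in U" using assms nb
    by (intro bullI[of p a q y b]) (auto simp: adj_commute)
  then show False using assms by blast
qed

text \<open>
  If every vertex mixed on \<open>C\<close> is complete to the centres, then \<open>prime_edge\<close> applies to the union of
  \<open>C\<close>, the mixed vertices and the anticentres complete to all centres. The remaining case of
  \<open>no_center_anticenter\<close> is this one in the complement.
\<close>
lemma no_center_anticenter_aux:
  assumes "prime_on U" "\<not> bull_in U" "prime_on C" "\<not> split C" "C \<subseteq> U"
    and "a \<in> U" "\<forall>c\<in>C. adj a c" "b \<in> U" "b \<notin> C" "\<forall>c\<in>C. \<not> adj b c"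
    and complete: "\<And>y a. \<lbrakk>y \<in> U - C; \<exists>c\<in>C. \<not> adj y c; \<exists>c\<in>C. adj y c; a \<in> U; \<forall>c\<in>C. adj a c\<rbrakk> \<Longrightarrow> adj y a"
  shows False
proof -
  interpret co: simple_graph "\<lambda>u v. u \<noteq> v \<and> \<not> adj u v" by (rule complement_simple_graph)
  define A where "A = {a\<in>U. \<forall>c\<in>C. adj a c}"
  have "C \<noteq> {}" using assms(4) unfolding split_def is_clique_def is_stable_def by auto
  then obtain p q where pq: "p \<in> C" "q \<in> C" "adj p q"
  proof -
    obtain p where "p \<in> C" using \<open>C \<noteq> {}\<close> by blast
    moreover have "{p} \<noteq> C"
      using assms(4) unfolding split_def is_clique_def is_stable_def by auto
    ultimately show ?thesis using cut_edge[OF assms(3,4), of "{p}"] that by auto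
  qed
  define B2 where "B2 = {b\<in>U. b \<notin> C \<and> (\<forall>c\<in>C. \<not> adj b c) \<and> (\<forall>a\<in>A. adj a b)}"
  define Y where "Y = {y\<in>U-C. (\<exists>c\<in>C. \<not> adj y c) \<and> (\<exists>c\<in>C. adj y c)}"
  have aA: "a \<in> A" "a \<notin> C" using assms by (auto simp: A_def)
  \<comment> \<open>\<open>a\<close> shows that the union is proper: \<open>Y\<close> requires a
    non-neighbour in \<open>C\<close>, and \<open>B2\<close> admits no neighbour in
    \<open>C\<close>.\<close>
  then have "a \<notin> C \<union> Y \<union> B2" using pq by (auto simp: Y_def B2_def A_def)
  then have N: "C \<union> Y \<union> B2 \<subseteq> U" "C \<union> Y \<union> B2 \<noteq> U"
    using assms(5,6) by (auto simp: Y_def B2_def)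
  obtain x y z where z: "x \<in> C \<union> Y \<union> B2" "y \<in> C \<union> Y \<union> B2" "z \<in> U" "z \<notin> C \<union> Y \<union> B2"
      "adj x y" "adj z x" "\<not> adj z y"
    by (rule prime_edge[OF assms(1) N, of p q]) (use pq in auto)
  have Acomplete: "adj a' x" if "a' \<in> A" "x \<in> C \<union> Y \<union> B2" for a' x
    using that complete[of x a'] unfolding A_def Y_def B2_def by (auto dest: adj_sym)
  have "z \<notin> A" using Acomplete z by blast
  \<comment> \<open>\<open>z\<close> is neither a centre nor mixed on \<open>C\<close>, so only an
    anticentre remains.\<close>
  then have zC: "\<forall>c\<in>C. \<not> adj z c" using z unfolding Y_def A_def by blast
  then obtain a' where a': "a' \<in> A" "\<not> adj a' z" using z unfolding B2_def by blast
  \<comment> \<open>In the complement \<open>z\<close> is a centre and \<open>a'\<close> an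
    anticentre, so an edge \<open>z y'\<close> would propagate to a non-edge \<open>y' a'\<close>,
    against completeness.\<close>
  have zY: "\<not> adj z y'" if "y' \<in> Y" for y'
  proof
    assume "adj z y'"
    have y': "y' \<in> U - C" "\<exists>c\<in>C. \<not> adj y' c" "\<exists>c\<in>C. adj y' c" using that by (auto simp: Y_def)
    have "y' \<noteq> a' \<and> \<not> adj y' a'"
    proof (rule co.anticenter_propagates[of C U y' z a'])
      show "co.prime_on C" using assms prime_on_complement by blast
      show "\<not> co.bull_in U" using assms bull_in_complement by blast
      show "\<not> co.split C" using assms split_complement by blast
      show "y' \<in> U" "z \<in> U" "a' \<in> U" "C \<subseteq> U" using y' z a' assms(5) by (auto simp: A_def)
      show "\<exists>c\<in>C. \<not> (y' \<noteq> c \<and> \<not> adj y' c)" using y'(3) by blast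
      show "\<exists>c\<in>C. y' \<noteq> c \<and> \<not> adj y' c" using y'(1,2) by (metis Diff_iff)
      show "\<forall>c\<in>C. z \<noteq> c \<and> \<not> adj z c" using z(4) zC by blast
      show "\<forall>c\<in>C. \<not> (a' \<noteq> c \<and> \<not> adj a' c)" using a'(1) by (auto simp: A_def)
      show "\<not> (y' \<noteq> z \<and> \<not> adj y' z)" using \<open>adj z y'\<close> adj_sym by blast
      show "z \<noteq> a' \<and> \<not> adj z a'" using a' \<open>z \<notin> A\<close> adj_sym by blast
    qed
    then show False using Acomplete a' that by (auto simp: adj_commute)
  qed
  \<comment> \<open>\<open>z\<close> has no neighbour in \<open>C\<close> or \<open>Y\<close>. Being
    an anticentre, \<open>x\<close> in turn has no neighbour in \<open>C\<close>, which restricts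
    \<open>y\<close>.\<close>
  have "x \<in> B2" using z zC zY by blast
  then have xC: "\<forall>c\<in>C. \<not> adj x c" by (simp add: B2_def)
  then have "y \<in> Y \<union> B2" using z(2,5) by blast
  then have "\<exists>c\<in>C. \<not> adj y c" using pq(1) by (auto simp: B2_def Y_def)
  then obtain c where "c \<in> C" "\<not> adj x c" "\<not> adj y c" using xC by blast
  moreover have "adj a' c" using a' \<open>c \<in> C\<close> by (auto simp: A_def)
  moreover have "adj a' x" "adj a' y" using Acomplete a' z by blast+
  moreover have "a' \<in> U" "x \<in> U" "y \<in> U" "c \<in> U"
    using a' z(1,2) N(1) \<open>c \<in> C\<close> assms(5) by (auto simp: A_def)
  ultimately have "bull_in U" using z(3,5-7) a'(2) zC
    by (intro bullI[of x a' y z c]) (auto simp: adj_commute)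
  then show False using assms by blast
qed

text \<open>If some mixed \<open>y0\<close> misses a centre \<open>a0\<close>, then every mixed
  vertex misses every anticentre outside \<open>C\<close>. This is the hypothesis of the auxiliary
  lemma in the complement, where \<open>b\<close> is the centre and \<open>a0\<close> the
  anticentre.\<close>

lemma no_center_anticenter:
  assumes "prime_on U" "\<not> bull_in U" "prime_on C" "\<not> split C" "C \<subseteq> U"
    and "a \<in> U" "\<forall>c\<in>C. adj a c" "b \<in> U" "b \<notin> C" "\<forall>c\<in>C. \<not> adj b c"
  shows False
proof (cases "\<forall>y a. y \<in> U - C \<longrightarrow> (\<exists>c\<in>C. \<not> adj y c) \<longrightarrow> (\<exists>c\<in>C. adj y c) \<longrightarrow> a \<in> U \<longrightarrow>
    (\<forall>c\<in>C. adj a c) \<longrightarrow> adj y a")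
  case True
  then show False using no_center_anticenter_aux[OF assms] by blast
next
  case False
  then obtain y0 a0 where y0: "y0 \<in> U - C" "\<exists>c\<in>C. \<not> adj y0 c" "\<exists>c\<in>C. adj y0 c"
    "a0 \<in> U" "\<forall>c\<in>C. adj a0 c" "\<not> adj y0 a0" by blast
  interpret co: simple_graph "\<lambda>u v. u \<noteq> v \<and> \<not> adj u v" by (rule complement_simple_graph)
  have co: "co.prime_on U" "\<not> co.bull_in U" "co.prime_on C" "\<not> co.split C"
    using assms prime_on_complement bull_in_complement split_complement by blast+
  have y0B: "\<not> adj y0 b" if "b \<in> U" "\<forall>c\<in>C. \<not> adj b c" for b
    using center_or_anticenter[OF assms(3,4,5,2), of y0 a0 b] y0 that by blast
  have a0B: "\<not> adj a0 b" if "b \<in> U" "\<forall>c\<in>C. \<not> adj b c" for b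
    using anticenter_propagates[OF assms(3,5,2), of y0 a0 b] y0 y0B that assms(4) by blast
  have yB: "\<not> adj y b" if y: "y \<in> U - C" "\<exists>c\<in>C. \<not> adj y c" "\<exists>c\<in>C. adj y c"
    and b: "b \<in> U" "b \<notin> C" "\<forall>c\<in>C. \<not> adj b c" for y b
  proof
    assume yb: "adj y b"
    \<comment> \<open>An edge \<open>y b\<close> is contradictory: it forces \<open>y a0\<close>
      here, whereas propagation in the complement forbids \<open>y a0\<close>.\<close>
    have ya: "adj y a0"
      using center_or_anticenter[OF assms(3,4,5,2), of y a0 b] y y0 b yb by blast
    have "y \<noteq> a0 \<and> \<not> adj y a0"
    proof (rule co.anticenter_propagates[of C U y b a0])
      show "y \<in> U" using y by blast
      show "\<exists>c\<in>C. \<not> (y \<noteq> c \<and> \<not> adj y c)" using y(3) by blast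
      show "\<exists>c\<in>C. y \<noteq> c \<and> \<not> adj y c" using y(1,2) by (metis Diff_iff)
      show "\<forall>c\<in>C. b \<noteq> c \<and> \<not> adj b c" using b by blast
      show "\<forall>c\<in>C. \<not> (a0 \<noteq> c \<and> \<not> adj a0 c)" using y0(5) by blast
      show "\<not> (y \<noteq> b \<and> \<not> adj y b)" using yb by blast
      have "b \<noteq> a0" using b y0(3,5) by blast
      then show "b \<noteq> a0 \<and> \<not> adj b a0" using a0B[of b] b adj_sym by blast
    qed (use co y0 b assms(5) in blast)+
    then show False using ya by blast
  qed
  have aC: "a0 \<notin> C" using y0 by auto
  show False
  proof (rule co.no_center_anticenter_aux[OF co(1-4) assms(5), of b a0])
    show "\<forall>c\<in>C. b \<noteq> c \<and> \<not> adj b c" using assms(9,10) by blast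
    show "\<forall>c\<in>C. \<not> (a0 \<noteq> c \<and> \<not> adj a0 c)" using y0(5) by blast
    fix y b' assume y: "y \<in> U - C" "\<exists>c\<in>C. \<not> (y \<noteq> c \<and> \<not> adj y c)" "\<exists>c\<in>C. y \<noteq> c \<and> \<not> adj y c"
      and b': "b' \<in> U" "\<forall>c\<in>C. b' \<noteq> c \<and> \<not> adj b' c"
    then have "\<exists>c\<in>C. \<not> adj y c" "\<exists>c\<in>C. adj y c" "b' \<notin> C" by blast+
    then have "\<not> adj y b'" "y \<noteq> b'" using yB y b' by blast+
    then show "y \<noteq> b' \<and> \<not> adj y b'" by blast
  qed (use assms(8) y0(4) aC in blast)+
qed

end

section \<open>Triangles and their traces on a core \<open>C\<close>\<close>

locale bull_free_core = simple_graph +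
  fixes U C :: "'a set" and v0 :: 'a
  assumes prime_U: "prime_on U" and bull_free: "\<not> bull_in U"
    and CU: "C \<subseteq> U" and prime_C: "prime_on C" and not_split_C: "\<not> split C"
    and no_domination_C: "no_domination C"
    and v0: "v0 \<in> U" "v0 \<notin> C" "\<forall>c\<in>C. \<not> adj v0 c"
begin

definition B :: "'a set" where
  "B = {b\<in>U. b \<notin> C \<and> (\<forall>c\<in>C. \<not> adj b c)}"

definition R :: "'a set" where
  "R = U - C - B"

definition S :: "'a \<Rightarrow> 'a set" where
  "S x = {c\<in>C. adj x c}"

lemma BD: "b \<in> B \<Longrightarrow> b \<in> U" "b \<in> B \<Longrightarrow> c \<in> C \<Longrightarrow> \<not> adj b c"
    "b \<in> B \<Longrightarrow> c \<in> C \<Longrightarrow> \<not> adj c b" "b \<in> B \<Longrightarrow> b \<notin> C" "b \<in> B \<Longrightarrow> b \<notin> R"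
  using adj_sym by (auto simp: B_def R_def)

lemma RU: "x \<in> R \<Longrightarrow> x \<in> U" "x \<in> R \<Longrightarrow> x \<notin> C"
  by (auto simp: R_def)

lemma S_memD: "s \<in> S x \<Longrightarrow> s \<in> C" "s \<in> S x \<Longrightarrow> adj x s" "s \<in> S x \<Longrightarrow> adj s x" "s \<in> S x \<Longrightarrow> s \<in> U"
  using adj_sym CU by (auto simp: S_def)

lemma S_notmemD: "c \<in> C \<Longrightarrow> c \<notin> S x \<Longrightarrow> \<not> adj x c" "c \<in> C \<Longrightarrow> c \<notin> S x \<Longrightarrow> \<not> adj c x"
  using adj_sym by (auto simp: S_def)

text \<open>\<open>v0\<close> is an anticentre, so a centre would contradict
  \<open>no_center_anticenter\<close>. Hence every vertex of \<open>R\<close> is mixed on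
  \<open>C\<close>.\<close>

lemma not_center: "x \<in> U \<Longrightarrow> \<exists>c\<in>C. \<not> adj x c"
  using no_center_anticenter[OF prime_U bull_free prime_C not_split_C CU _ _ v0] by blast

lemma S_nonempty:
  assumes "x \<in> R" obtains s where "s \<in> S x"
  using assms by (auto simp: R_def B_def S_def)

lemma stable_S:
  assumes "x \<in> R" "b \<in> B" "adj x b"
  shows "is_stable (S x)"
  unfolding S_def
  by (rule neighbours_stable[OF prime_C CU bull_free, of x b])
    (use assms not_center RU BD in auto)

lemma S_nonadj:
  assumes "x \<in> R" "b \<in> B" "adj x b" "s \<in> S x" "t \<in> S x"
  shows "\<not> adj s t"
  using stable_S[OF assms(1-3)] assms(4,5) by (auto simp: is_stable_def)

lemma S_nbr:
  assumes "x \<in> R" "b \<in> B" "adj x b" "s \<in> S x" "t \<in> C" "adj s t"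
  shows "t \<notin> S x"
  using S_nonadj[OF assms(1-4)] assms(6) by blast

lemma nbr_exists:
  assumes "s \<in> C" obtains t where "t \<in> C" "adj s t"
proof -
  have "{s} \<noteq> C"
    using not_split_C unfolding split_def is_clique_def is_stable_def by auto
  then show ?thesis
    using cut_edge[OF prime_C not_split_C, of "{s}"] assms that by blast
qed

lemma not_split_U: "\<not> split U"
  using split_subset CU not_split_C by blast

lemma v0_B: "v0 \<in> B"
  using v0 by (auto simp: B_def)

text \<open>Otherwise the triangle \<open>x\<close>, \<open>u\<close>, \<open>b\<close> with
  pendants \<open>s\<close> at \<open>x\<close> and \<open>t\<close> at \<open>u\<close> is a
  bull.\<close>

lemma private_adj:
  assumes "b \<in> B" "x \<in> R" "u \<in> R" "adj b x" "adj b u" "adj x u"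
    and "s \<in> S x" "s \<notin> S u" "t \<in> S u" "t \<notin> S x"
  shows "adj s t"
proof (rule ccontr)
  assume "\<not> adj s t"
  moreover have "s \<in> C" "t \<in> C" using assms S_memD by blast+
  then have "\<not> adj u s" "\<not> adj x t" "\<not> adj b s" "\<not> adj b t" using assms S_notmemD BD by blast+
  moreover have "adj x s" "adj u t" "b \<in> U" "x \<in> U" "u \<in> U" "s \<in> U" "t \<in> U"
    using assms S_memD BD RU by blast+
  ultimately have "bull_in U" using assms(4-6)
    by (intro bullI[of x u b s t]) (auto simp: adj_commute)
  then show False using bull_free by blast
qed

lemma S_subset_house:
  assumes "\<not> house_in U"
    and "b \<in> B" "x \<in> R" "u \<in> R" "adj b x" "adj b u" "adj x u"
  shows "S x \<subseteq> S u"
proof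
  fix y assume y: "y \<in> S x"
  have xb: "adj x b" and ub: "adj u b" and ux: "adj u x" using assms adj_sym by blast+
  have U: "b \<in> U" "x \<in> U" "u \<in> U" using assms BD RU by blast+
  show "y \<in> S u"
  proof (rule ccontr)
    assume yu: "y \<notin> S u"
    have yC: "y \<in> C" using y S_memD by blast
    \<comment> \<open>A private neighbour \<open>s\<close> of \<open>u\<close> would be adjacent to
      \<open>y\<close>, making \<open>b\<close> the roof over the four-cycle \<open>x\<close>,
      \<open>u\<close>, \<open>s\<close>, \<open>y\<close>.\<close>
    have sub: "S u \<subseteq> S x"
    proof (rule ccontr)
      assume "\<not> S u \<subseteq> S x"
      then obtain s where s: "s \<in> S u" "s \<notin> S x" by blast
      have sC: "s \<in> C" using s S_memD by blast
      have "adj y s" using private_adj[OF assms(2-7) y yu s] .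
      moreover have "\<not> adj u y" "\<not> adj x s" "\<not> adj b y" "\<not> adj b s"
        using S_notmemD yC sC s yu BD assms by blast+
      moreover have "adj x y" "adj u s" "y \<in> U" "s \<in> U" using S_memD y s by blast+
      ultimately have "house_in U" using assms(5-7) U
        by (intro houseI[of b x u y s]) (auto simp: adj_commute)
      then show False using assms by blast
    qed
    obtain s where s: "s \<in> S u" using S_nonempty assms by blast
    then have sx: "s \<in> S x" using sub by blast
    have "s \<noteq> y" using s yu by blast
    moreover have ns: "\<not> adj s y" using S_nonadj[OF assms(3,2) xb sx y] .
    \<comment> \<open>\<open>t\<close> distinguishes \<open>s\<close> from \<open>y\<close>, and
      stability of \<open>S x\<close> keeps \<open>t\<close> outside both traces; the triangle
      \<open>x\<close>, \<open>s\<close>, \<open>u\<close> with pendants \<open>y\<close> and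
      \<open>t\<close> will be a bull.\<close>
    ultimately obtain t where t: "t \<in> C" "adj s t" "\<not> adj y t"
      using no_domination_C yC S_memD(1)[OF s] unfolding no_domination_def by blast
    have "t \<notin> S x" using S_nbr[OF assms(3,2) xb sx t(1,2)] .
    then have "\<not> adj x t" "\<not> adj u t" using sub S_notmemD t(1) by blast+
    moreover have "adj x s" "adj u s" "adj x y" "\<not> adj u y" "s \<in> U" "y \<in> U" "t \<in> U"
      using S_memD S_notmemD s sx y yC yu t CU by blast+
    ultimately have "bull_in U" using t assms(7) ns U
      by (intro bullI[of x s u y t]) (auto simp: adj_commute)
    then show False using bull_free by blast
  qed
qed

text \<open>A neighbour \<open>t\<close> of \<open>s\<close> avoids the stable set
  \<open>S x\<close>; if it avoided \<open>S u\<close> too, the triangle \<open>b\<close>,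
  \<open>u\<close>, \<open>x\<close> and the path \<open>x\<close>, \<open>s\<close>,
  \<open>t\<close> would form a hammer.\<close>

lemma private_nbr_hammer:
  assumes "\<not> hammer_in U"
    and "b \<in> B" "x \<in> R" "u \<in> R" "adj b x" "adj b u" "adj x u"
    and "s \<in> S x - S u" "t \<in> C"
  shows "adj s t \<longleftrightarrow> t \<in> S u - S x"
proof
  show "t \<in> S u - S x \<Longrightarrow> adj s t" using private_adj[OF assms(2-7)] assms(8) by blast
  assume st: "adj s t"
  have xb: "adj x b" using assms adj_sym by blast
  have U: "b \<in> U" "x \<in> U" "u \<in> U" using assms BD RU by blast+
  have tx: "t \<notin> S x" using S_nbr[OF assms(3,2) xb _ assms(9) st] assms(8) by blast
  moreover have "t \<in> S u"
  proof (rule ccontr)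
    assume "t \<notin> S u"
    have sC: "s \<in> C" using assms S_memD by blast
    have "\<not> adj u t" "\<not> adj x t" "\<not> adj u s" "\<not> adj b s" "\<not> adj b t"
      using S_notmemD sC assms(2,8,9) tx \<open>t \<notin> S u\<close> BD by blast+
    moreover have "adj x s" "s \<in> U" "t \<in> U" using S_memD assms CU by blast+
    ultimately have "hammer_in U" using st assms(5-7) U
      by (intro hammerI[of b u x s t]) (auto simp: adj_commute)
    then show False using assms by blast
  qed
  ultimately show "t \<in> S u - S x" by blast
qed

text \<open>If \<open>x\<close> has a private neighbour, the private neighbours of \<open>x\<close>
  and of \<open>u\<close> exhaust \<open>C\<close> and split it into a clique and a stable
  set.\<close>

lemma S_subset_hammer:
  assumes "\<not> hammer_in U"
    and "b \<in> B" "x \<in> R" "u \<in> R" "adj b x" "adj b u" "adj x u"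
  shows "S x \<subseteq> S u"
proof (rule ccontr)
  assume "\<not> ?thesis"
  then have ne: "S x - S u \<noteq> {}" by blast
  have xb: "adj x b" and ub: "adj u b" and ux: "adj u x" using assms adj_sym by blast+
  have 1: "adj s t \<longleftrightarrow> t \<in> S u - S x" if "s \<in> S x - S u" "t \<in> C" for s t
    using private_nbr_hammer[OF assms that] .
  have 2: "adj s t \<longleftrightarrow> t \<in> S x - S u" if "s \<in> S u - S x" "t \<in> C" for s t
    using private_nbr_hammer[OF assms(1,2,4,3,6,5) ux that] .
  have "S x - S u \<subseteq> C" "S u - S x \<subseteq> C" using S_memD by blast+
  \<comment> \<open>By 1 and 2 no edge of \<open>C\<close> leaves the symmetric difference of the
    traces.\<close>
  have "C = (S x - S u) \<union> (S u - S x)"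
  proof (rule ccontr)
    assume "C \<noteq> (S x - S u) \<union> (S u - S x)"
    then obtain p q where "p \<in> (S x - S u) \<union> (S u - S x)" "q \<in> C - ((S x - S u) \<union> (S u - S x))" "adj p q"
      using cut_edge[OF prime_C not_split_C, of "(S x - S u) \<union> (S u - S x)"] ne
        \<open>S x - S u \<subseteq> C\<close> \<open>S u - S x \<subseteq> C\<close> by blast
    then show False using 1 2 by blast
  qed
  \<comment> \<open>By 1 all vertices of this set have the same neighbours in \<open>C\<close>, so
    two non-adjacent ones would violate \<open>no_domination\<close>.\<close>
  moreover have "is_clique (S x - S u)"
    unfolding is_clique_def
  proof (intro ballI impI, rule ccontr)
    fix p q assume "p \<in> S x - S u" "q \<in> S x - S u" "p \<noteq> q" "\<not> adj p q"
    moreover obtain t where "t \<in> C" "adj p t" "\<not> adj q t"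
      using no_domination_C calculation \<open>S x - S u \<subseteq> C\<close> unfolding no_domination_def by blast
    ultimately show False using 1 by blast
  qed
  moreover have "is_stable (S u - S x)"
    using stable_S[OF assms(4,2) ub] unfolding is_stable_def by blast
  ultimately show False using not_split_C unfolding split_def by blast
qed

lemma S_eq:
  assumes "\<not> house_in U \<or> \<not> hammer_in U"
    and "b \<in> B" "x \<in> R" "u \<in> R" "adj b x" "adj b u" "adj x u"
  shows "S x = S u"
proof -
  have ux: "adj u x" using assms(7) by (rule adj_sym)
  show ?thesis
  proof (cases "house_in U")
    case True
    then have "\<not> hammer_in U" using assms(1) by blast
    then show ?thesis
      using S_subset_hammer[OF _ assms(2-7)] S_subset_hammer[OF _ assms(2,4,3,6,5) ux] by blast
  next
    case False
    then show ?thesis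
      using S_subset_house[OF _ assms(2-7)] S_subset_house[OF _ assms(2,4,3,6,5) ux] by blast
  qed
qed

text \<open>Without hammers, continue the triangle by a path from \<open>x\<close> into
  \<open>C\<close>. Without houses, \<open>prime_edge\<close> on the neighbours of \<open>x\<close>
  in \<open>B\<close> yields a triangle \<open>v'\<close>, \<open>x\<close>, \<open>w\<close> with
  two vertices in \<open>R\<close>, whose equal traces give a bull.\<close>

lemma no_triangle_BBR:
  assumes H: "\<not> house_in U \<or> \<not> hammer_in U"
    and "b \<in> B" "u \<in> B" "x \<in> R" "adj b u" "adj x b" "adj x u"
  shows False
proof (cases "house_in U")
  case True
  obtain s where s: "s \<in> S x" using S_nonempty assms by blast
  then obtain t where t: "t \<in> C" "adj s t" using nbr_exists S_memD by blast
  have "t \<notin> S x" using S_nbr[OF assms(4,2,6) s t] .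
  then have "\<not> adj x t" "adj x s" "s \<in> C" "s \<in> U" "t \<in> U" using S_notmemD S_memD s t CU by blast+
  moreover have "\<not> adj b s" "\<not> adj b t" "\<not> adj u s" "\<not> adj u t" "b \<in> U" "u \<in> U" "x \<in> U"
    using BD RU assms \<open>s \<in> C\<close> t by blast+
  ultimately have "hammer_in U" using t(2) assms(5-7)
    by (intro hammerI[of b u x s t]) (auto simp: adj_commute)
  then show False using True H by blast
next
  case False
  define N where "N = {b\<in>B. adj x b}"
  have "x \<in> U" "x \<notin> N" using assms(4) RU by (auto simp: N_def)
  then have "N \<noteq> U" by blast
  then have N: "N \<subseteq> U" "N \<noteq> U" "b \<in> N" "u \<in> N"
    using assms(2,3,6,7) BD(1) unfolding N_def by blast+
  obtain v' u' w where w: "v' \<in> N" "u' \<in> N" "w \<in> U" "w \<notin> N" "adj v' u'" "adj w v'" "\<not> adj w u'"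
    using prime_edge[OF prime_U N assms(5)] by blast
  have v'u': "v' \<in> B" "u' \<in> B" "adj x v'" "adj x u'" using w by (auto simp: N_def)
  have wC: "w \<notin> C" using BD(3) v'u' w by blast
  obtain s where s: "s \<in> S x" using S_nonempty assms by blast
  have sC: "s \<in> C" "s \<in> U" "adj x s" using s S_memD by blast+
  have ns: "\<not> adj v' s" "\<not> adj u' s" using BD v'u' sC by blast+
  have U: "v' \<in> U" "u' \<in> U" "x \<in> U" using BD v'u' RU assms by blast+
  \<comment> \<open>If \<open>x\<close> missed \<open>w\<close>, then \<open>u'\<close> would be the
    roof over \<open>x\<close>, \<open>v'\<close>, \<open>w\<close>, \<open>s\<close> when
    \<open>w\<close> sees \<open>s\<close>; otherwise \<open>s\<close> and \<open>w\<close> would be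
    the pendants of a bull.\<close>
  have xw: "adj x w"
  proof (rule ccontr)
    assume "\<not> adj x w"
    show False
    proof (cases "adj w s")
      case True
      then have "house_in U" using w(3,5-7) v'u'(3,4) sC ns U \<open>\<not> adj x w\<close>
        by (intro houseI[of u' x v' s w]) (auto simp: adj_commute)
      then show False using False by blast
    next
      case False
      then have "bull_in U" using w(3,5-7) v'u'(3,4) sC ns U \<open>\<not> adj x w\<close>
        by (intro bullI[of x v' u' s w]) (auto simp: adj_commute)
      then show False using bull_free by blast
    qed
  qed
  then have wR: "w \<in> R" using w wC unfolding N_def R_def by blast
  have v'w: "adj v' w" "adj v' x" using w v'u' adj_sym by blast+
  have "S x = S w" using S_eq[OF H v'u'(1) assms(4) wR v'w(2,1) xw] .
  obtain t where t: "t \<in> C" "adj s t" using nbr_exists sC by blast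
  have "t \<notin> S x" using S_nbr[OF assms(4) v'u'(1,3) s t] .
  then have "\<not> adj x t" "\<not> adj w t" using S_notmemD t(1) \<open>S x = S w\<close> by blast+
  moreover have "adj w s" using s S_memD \<open>S x = S w\<close> by simp
  moreover have "\<not> adj u' t" "t \<in> U" using BD(2) v'u'(2) t(1) CU by blast+
  ultimately have "bull_in U" using xw v'u'(3,4) w(3,7) ns sC t U
    by (intro bullI[of x s w u' t]) (auto simp: adj_commute)
  then show False using bull_free by blast
qed

text \<open>\<open>prime_edge\<close> on the neighbours of \<open>v\<close> in \<open>R\<close>
  gives \<open>x'\<close>, \<open>u'\<close> with a common trace and a vertex \<open>y\<close>
  seeing only \<open>x'\<close>. Excluding bulls shrinks the trace to one vertex \<open>s0\<close>
  and makes the trace of \<open>y\<close> the closed neighbourhood of \<open>s0\<close> in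
  \<open>C\<close>; an edge leaving it completes a last bull.\<close>

lemma no_triangle_BRR:
  assumes H: "\<not> house_in U \<or> \<not> hammer_in U"
    and "v \<in> B" "x \<in> R" "u \<in> R" "adj v x" "adj v u" "adj x u"
  shows False
proof -
  define N where "N = {x\<in>R. adj v x}"
  have "v \<in> U" "v \<notin> N" using assms(2) BD by (auto simp: N_def)
  then have "N \<noteq> U" by blast
  then have N: "N \<subseteq> U" "N \<noteq> U" "x \<in> N" "u \<in> N"
    using assms(3-6) RU unfolding N_def by blast+
  obtain x' u' y where y: "x' \<in> N" "u' \<in> N" "y \<in> U" "y \<notin> N" "adj x' u'" "adj y x'" "\<not> adj y u'"
    using prime_edge[OF prime_U N assms(7)] by blast
  have x'u': "x' \<in> R" "u' \<in> R" "adj v x'" "adj v u'" "adj x' v" "adj u' v"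
    using y by (auto simp: N_def adj_commute)
  have Seq: "S x' = S u'" using S_eq[OF H assms(2) x'u'(1-4) y(5)] .
  have U: "v \<in> U" "x' \<in> U" "u' \<in> U" using BD assms RU x'u' by blast+
  \<comment> \<open>A vertex of \<open>C\<close> sees both or neither of \<open>x'\<close> and
    \<open>u'\<close>, as their traces agree.\<close>
  have yC: "y \<notin> C" using Seq y(6,7) by (auto simp: S_def adj_commute)
  have t_nonadj: "\<not> adj x' t" "\<not> adj u' t" if "s \<in> S x'" "t \<in> C" "adj s t" for s t
    using S_nbr[OF x'u'(1) assms(2) x'u'(5) that] Seq S_notmemD that by blast+
  have S_lits: "s \<in> C" "s \<in> U" "adj x' s" "adj u' s" "\<not> adj v s" if "s \<in> S x'" for s
    using that Seq S_memD BD assms(2) by blast+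
  have C_lits: "c \<in> U" "\<not> adj v c" if "c \<in> C" for c
    using that BD assms(2) CU by blast+
  \<comment> \<open>Otherwise the triangle \<open>x'\<close>, \<open>s\<close>, \<open>u'\<close>
    has the pendants \<open>y\<close> and \<open>t\<close>.\<close>
  have tri: "adj y t" if "s \<in> S x'" "t \<in> C" "adj s t" "\<not> adj y s" for s t
  proof (rule ccontr)
    assume "\<not> adj y t"
    then have "bull_in U" using S_lits[OF that(1)] C_lits[OF that(2)] t_nonadj[OF that(1-3)] that(3,4)
        y(3,5-7) U by (intro bullI[of x' s u' y t]) (auto simp: adj_commute)
    then show False using bull_free by blast
  qed
  obtain s0 where s0: "s0 \<in> S x'" using S_nonempty x'u' by blast
  obtain t0 where t0: "t0 \<in> C" "adj s0 t0" using nbr_exists S_lits s0 by blast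
  have "y \<notin> B"
  proof
    assume "y \<in> B"
    then show False using tri[OF s0 t0] BD S_lits[OF s0] t0 by blast
  qed
  then have "y \<in> R" using y(3) yC by (auto simp: R_def)
  then have yv: "\<not> adj y v" using y(4) by (auto simp: N_def adj_commute)
  \<comment> \<open>A missed \<open>s\<close> yields both a house with roof \<open>u'\<close> and a
    hammer on \<open>v\<close>, \<open>u'\<close>, \<open>x'\<close>, \<open>y\<close>,
    \<open>t\<close>, so either alternative of \<open>H\<close> is contradicted.\<close>
  have yS: "adj y s" if s: "s \<in> S x'" for s
  proof (rule ccontr)
    assume ys: "\<not> adj y s"
    obtain t where t: "t \<in> C" "adj s t" using nbr_exists S_lits s by blast
    have lits: "adj y t" using tri[OF s t ys] .
    have "house_in U"
      using S_lits[OF s] C_lits[OF t(1)] t_nonadj[OF s t] t(2) ys lits y(3,5-7) U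
      by (intro houseI[of u' x' s y t]) (auto simp: adj_commute)
    moreover have "hammer_in U"
      using C_lits[OF t(1)] t_nonadj[OF s t] yv lits y(3,5-7) U x'u'(3,4)
      by (intro hammerI[of v u' x' y t]) (auto simp: adj_commute)
    ultimately show False using H by blast
  qed
  \<comment> \<open>Otherwise the triangle \<open>x'\<close>, \<open>s\<close>, \<open>y\<close> has
    the pendants \<open>v\<close> and \<open>t\<close>.\<close>
  have yt: "adj y t" if "s \<in> S x'" "t \<in> C" "adj s t" for s t
  proof (rule ccontr)
    assume "\<not> adj y t"
    then have "bull_in U"
      using S_lits[OF that(1)] C_lits[OF that(2)] t_nonadj[OF that] that(3) yS[OF that(1)] y(3,6) yv U x'u'(3)
      by (intro bullI[of x' s y v t]) (auto simp: adj_commute)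
    then show False using bull_free by blast
  qed
  \<comment> \<open>Otherwise the triangle \<open>x'\<close>, \<open>y\<close>, \<open>s\<close> has
    the pendants \<open>v\<close> and \<open>q\<close>.\<close>
  have yq: "adj s q" if "s \<in> S x'" "q \<in> C" "q \<notin> S x'" "adj y q" for s q
  proof (rule ccontr)
    assume "\<not> adj s q"
    then have "bull_in U"
      using S_lits[OF that(1)] C_lits[OF that(2)] S_notmemD[OF that(2,3)] that(4) yS[OF that(1)] y(3,6) yv U x'u'(3)
      by (intro bullI[of x' y s v q]) (auto simp: adj_commute)
    then show False using bull_free by blast
  qed
  \<comment> \<open>A vertex \<open>t\<close> distinguishing \<open>s\<close> from \<open>s0\<close>
    is adjacent to \<open>y\<close> by \<open>yt\<close>, hence to \<open>s0\<close> by
    \<open>yq\<close>.\<close>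
  have S_single: "s = s0" if s: "s \<in> S x'" for s
  proof (rule ccontr)
    assume "s \<noteq> s0"
    moreover have "\<not> adj s s0" using S_nonadj[OF x'u'(1) assms(2) x'u'(5) s s0] .
    ultimately obtain t where t: "t \<in> C" "adj s t" "\<not> adj s0 t"
      using no_domination_C S_lits s s0 unfolding no_domination_def by blast
    moreover have "t \<notin> S x'" using S_nbr[OF x'u'(1) assms(2) x'u'(5) s t(1,2)] .
    ultimately show False using yt[OF s t(1,2)] yq[OF s0] by blast
  qed
  define X where "X = insert s0 {c\<in>C. adj s0 c}"
  have yX: "adj y c \<longleftrightarrow> c \<in> X" if "c \<in> C" for c
    using that yS[OF s0] yt[OF s0] yq[OF s0] S_single unfolding X_def by blast
  obtain c where "c \<in> C" "\<not> adj y c" using not_center y(3) by blast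
  then have "X \<subseteq> C" "X \<noteq> {}" "X \<noteq> C" using yX S_lits s0 unfolding X_def by blast+
  \<comment> \<open>\<open>y\<close> is not a centre, so \<open>X\<close> is proper. The end
    \<open>t\<close> differs from \<open>s0\<close>, whose neighbours in \<open>C\<close> all lie in
    \<open>X\<close>.\<close>
  then obtain t r where tr: "t \<in> X" "r \<in> C - X" "adj t r"
    using cut_edge[OF prime_C not_split_C] by blast
  then have t: "t \<in> C" "adj s0 t" using S_lits s0 unfolding X_def by auto
  have r: "r \<in> C" "\<not> adj y r" "\<not> adj s0 r" "r \<notin> S x'" using tr yX S_single unfolding X_def by blast+
  have "\<not> adj u' r" using r Seq S_notmemD by blast
  then have "bull_in U"
    using r(2,3) t(2) tr(3) t_nonadj[OF s0 t] yt[OF s0 t] yS[OF s0] y(3,7) S_lits[OF s0]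
      C_lits[OF t(1)] C_lits[OF r(1)] U
    by (intro bullI[of s0 t y u' r]) (auto simp: adj_commute)
  then show False using bull_free by blast
qed

lemma no_mixed_triangle:
  assumes H: "\<not> house_in U \<or> \<not> hammer_in U"
    and "b \<in> B" "x \<in> R" "u \<in> U" "adj b x" "adj b u" "adj x u"
  shows False
proof -
  have "u \<notin> C" using assms BD by blast
  then consider "u \<in> B" | "u \<in> R" using assms(4) by (auto simp: R_def)
  then show False
  proof cases
    case 1
    then show False using no_triangle_BBR[OF H assms(2) 1 assms(3,6)] assms adj_sym by blast
  next
    case 2
    then show False using no_triangle_BRR[OF H assms(2,3) 2 assms(5-7)] by blast
  qed
qed

section \<open>Moving a triangle to the border between \<open>B\<close> and \<open>R\<close>\<close>

definition in_triangle :: "'a \<Rightarrow> bool" where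
  "in_triangle c \<longleftrightarrow> (\<exists>a\<in>U. \<exists>b\<in>U. adj a b \<and> adj c a \<and> adj c b)"

text \<open>If the edge \<open>c d\<close> had no common neighbour, \<open>N\<close> would contain
  the edge \<open>a b\<close>. A vertex \<open>w\<close> distinguishing an edge \<open>a' b'\<close>
  of \<open>N\<close> gives a house with roof \<open>b'\<close> or a bull, according to whether
  \<open>w\<close> sees \<open>d\<close>.\<close>

lemma house_free_edge_in_triangle:
  assumes "\<not> house_in U" "c \<in> U" "d \<in> U" "adj c d" "in_triangle c"
  shows "\<exists>w\<in>U. adj c w \<and> adj d w"
proof (rule ccontr)
  assume "\<not> ?thesis"
  then have no: "\<not> (adj c w \<and> adj d w)" if "w \<in> U" for w using that by blast
  define N where "N = {z\<in>U. adj c z \<and> \<not> adj d z \<and> z \<noteq> d}"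
  obtain a b where ab: "a \<in> U" "b \<in> U" "adj a b" "adj c a" "adj c b"
    using assms(5) unfolding in_triangle_def by blast
  have "c \<notin> N" by (simp add: N_def)
  then have "N \<noteq> U" using assms(2) by blast
  moreover have "\<not> adj d a" "\<not> adj d b" "a \<noteq> d" "b \<noteq> d" using no ab adj_sym by blast+
  ultimately have N: "N \<subseteq> U" "N \<noteq> U" "a \<in> N" "b \<in> N"
    using ab by (auto simp: N_def)
  obtain a' b' w where w: "a' \<in> N" "b' \<in> N" "w \<in> U" "w \<notin> N" "adj a' b'" "adj w a'" "\<not> adj w b'"
    using prime_edge[OF prime_U N ab(3)] by blast
  have ab': "adj c a'" "adj c b'" "\<not> adj d a'" "\<not> adj d b'" "a' \<in> U" "b' \<in> U" using w(1,2) by (auto simp: N_def)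
  \<comment> \<open>A neighbour \<open>w\<close> of \<open>c\<close> outside \<open>N\<close> would
    see \<open>d\<close> or equal it; \<open>w = d\<close> is impossible because \<open>d\<close>
    misses \<open>a'\<close>.\<close>
  have "\<not> adj c w" using w(3,4,6) no ab' unfolding N_def by blast
  show False
  proof (cases "adj w d")
    case True
    then have "house_in U" using w(3,5-7) ab' \<open>\<not> adj c w\<close> assms(2-4)
      by (intro houseI[of b' c a' d w]) (auto simp: adj_commute)
    then show False using assms by blast
  next
    case False
    then have "bull_in U" using w(3,5-7) ab' \<open>\<not> adj c w\<close> assms(2-4)
      by (intro bullI[of c a' b' d w]) (auto simp: adj_commute)
    then show False using bull_free by blast
  qed
qed

text \<open>\<open>cut_edge\<close> provides an edge leaving \<open>B\<close>; it cannot end in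
  \<open>C\<close>, since \<open>B\<close> is anticomplete to \<open>C\<close>.\<close>

lemma BR_edge: obtains b x where "b \<in> B" "x \<in> R" "adj b x"
proof -
  have "C \<noteq> {}" using not_split_C unfolding split_def is_clique_def is_stable_def by auto
  then have "B \<subseteq> U" "B \<noteq> {}" "B \<noteq> U" using v0_B BD CU by blast+
  then obtain b x where "b \<in> B" "x \<in> U - B" "adj b x"
    using cut_edge[OF prime_U not_split_U] by blast
  then show ?thesis using that BD(2) by (auto simp: R_def)
qed

text \<open>Lying in a triangle spreads along edges, so every vertex of \<open>U\<close> has this
  property. Then so does every edge, including one between \<open>B\<close> and
  \<open>R\<close>.\<close>

lemma house_free_contradiction:
  assumes "\<not> house_in U" "in_triangle v0"
  shows False
proof -
  define Q where "Q = {c\<in>U. in_triangle c}"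
  have "Q = U"
  proof (rule ccontr)
    assume "Q \<noteq> U"
    then obtain c d where cd: "c \<in> Q" "d \<in> U - Q" "adj c d"
      using cut_edge[OF prime_U not_split_U, of Q] assms(2) v0(1) unfolding Q_def by blast
    then obtain w where "w \<in> U" "adj c w" "adj d w"
      using house_free_edge_in_triangle[OF assms(1), of c d] unfolding Q_def by blast
    then have "in_triangle d" using cd adj_sym unfolding in_triangle_def Q_def by blast
    then show False using cd unfolding Q_def by blast
  qed
  obtain b x where bx: "b \<in> B" "x \<in> R" "adj b x" by (rule BR_edge)
  then have "b \<in> U" "x \<in> U" using BD RU by blast+
  moreover have "in_triangle b" using \<open>Q = U\<close> calculation unfolding Q_def by blast
  ultimately obtain w where "w \<in> U" "adj b w" "adj x w"
    using house_free_edge_in_triangle[OF assms(1)] bx by blast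
  then show False using no_mixed_triangle bx assms by blast
qed

text \<open>Layers count walks that start in \<open>R\<close> and then stay in \<open>B\<close>;
  unlike distance classes they may overlap.\<close>

primrec layer :: "nat \<Rightarrow> 'a set" where
  "layer 0 = R"
| "layer (Suc n) = {b\<in>B. \<exists>d\<in>layer n. adj b d}"

text \<open>A triangle as close to \<open>R\<close> as possible lies inside \<open>B\<close>, and
  two further steps towards \<open>R\<close> or into \<open>C\<close> form the handle of a
  hammer.\<close>

lemma hammer_free_contradiction:
  assumes "\<not> hammer_in U" "in_triangle v0"
  shows False
proof -
  \<comment> \<open>The last disjunct makes a triangle at layer 0 meet both \<open>B\<close> and
    \<open>R\<close>, so it is mixed.\<close>
  define T where "T n \<longleftrightarrow> (\<exists>t a b. t \<in> layer n \<and> a \<in> U \<and> b \<in> U \<and> adj t a \<and> adj t b \<and> adj a b \<and>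
    (t \<in> B \<or> a \<in> B))" for n
  have layer_sub: "layer n \<subseteq> B \<union> R" for n by (cases n) auto
  \<comment> \<open>An edge leaving the set \<open>Q\<close> of unreached vertices ends outside
    \<open>C\<close>, hence in some layer, which puts its other end in the next one.\<close>
  have "B \<subseteq> (\<Union>n. layer n)"
  proof (rule ccontr)
    define Q where "Q = B - (\<Union>n. layer n)"
    assume "\<not> ?thesis"
    then have "Q \<noteq> {}" "Q \<subseteq> U" using BD unfolding Q_def by blast+
    moreover obtain r where "r \<in> R" by (rule BR_edge)
    then have "Q \<noteq> U" using RU(1) BD(5) unfolding Q_def by blast
    ultimately obtain q x where qx: "q \<in> Q" "x \<in> U - Q" "adj q x"
      using cut_edge[OF prime_U not_split_U] by blast
    then have "x \<notin> C" using BD unfolding Q_def by blast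
    then have "x \<in> (\<Union>n. layer n) \<or> x \<in> layer 0" using qx(2) by (auto simp: Q_def R_def)
    then obtain n where "x \<in> layer n" by blast
    then have "q \<in> layer (Suc n)" using qx unfolding Q_def by auto
    then show False using qx unfolding Q_def by blast
  qed
  then obtain n0 where "v0 \<in> layer n0" using v0_B by blast
  then have "T n0" using assms(2) v0_B unfolding T_def in_triangle_def by blast
  define n where "n = (LEAST n. T n)"
  have "T n" unfolding n_def using \<open>T n0\<close> by (rule LeastI)
  have least: "\<not> T m" if "m < n" for m using that not_less_Least unfolding n_def by blast
  obtain t a b where t: "t \<in> layer n" "a \<in> U" "b \<in> U" "adj t a" "adj t b" "adj a b" "t \<in> B \<or> a \<in> B"
    using \<open>T n\<close> unfolding T_def by blast
  have "n \<noteq> 0"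
  proof
    assume "n = 0"
    then have "t \<in> R" "a \<in> B" using t BD by auto
    then show False using no_mixed_triangle[of a t b] assms(1) t adj_sym by blast
  qed
  then obtain m where m: "n = Suc m" by (cases n) auto
  then obtain d where d: "t \<in> B" "d \<in> layer m" "adj t d" using t(1) by auto
  have tU: "t \<in> U" using BD d by blast
  have dBR: "d \<in> B \<union> R" using d layer_sub by blast
  then have dU: "d \<in> U" using BD RU by blast
  have ta: "a \<notin> C" "b \<notin> C" using BD(2) d(1) t by blast+
  have aR: "a \<notin> R" using no_mixed_triangle[of t a b] assms(1) t d by blast
  have bR: "b \<notin> R" using no_mixed_triangle[of t b a] assms(1) t d adj_sym by blast
  have abB: "a \<in> B" "b \<in> B" using ta aR bR t by (auto simp: R_def)
  \<comment> \<open>A common neighbour \<open>z\<close> of \<open>d\<close> and \<open>t\<close>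
    would give a triangle at \<open>d\<close> in the earlier layer \<open>m\<close>, with
    \<open>t\<close> as its vertex in \<open>B\<close>.\<close>
  have no_tri: "\<not> adj d z" if "z \<in> U" "adj t z" for z
    using least[of m] m that d tU adj_sym unfolding T_def by blast
  have nd: "\<not> adj d a" "\<not> adj d b" using no_tri t by blast+
  show False
  proof (cases m)
    case 0
    then have dR: "d \<in> R" using d by simp
    obtain s where s: "s \<in> S d" using S_nonempty dR by blast
    then have "s \<in> C" "adj d s" "s \<in> U" using S_memD by blast+
    moreover have "\<not> adj t s" "\<not> adj a s" "\<not> adj b s" using BD \<open>s \<in> C\<close> d abB by blast+
    ultimately have "hammer_in U" using nd t(2-6) d(3) tU dU
      by (intro hammerI[of a b t d s]) (auto simp: adj_commute)
    then show False using assms by blast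
  next
    case (Suc k)
    then obtain e where e: "e \<in> layer k" "adj d e" using d by auto
    have eU: "e \<in> U" using e layer_sub BD RU by blast
    \<comment> \<open>A triangle vertex adjacent to \<open>e\<close> would itself lie in layer
      \<open>m\<close>, against the minimality of \<open>n\<close>.\<close>
    have ne: "\<not> adj z e" if z: "z \<in> B" "z' \<in> U" "z'' \<in> U" "adj z z'" "adj z z''" "adj z' z''" for z z' z''
    proof
      assume "adj z e"
      then have "z \<in> layer m" using e Suc z by auto
      then have "T m" using z unfolding T_def by blast
      then show False using least m by blast
    qed
    have "\<not> adj t e" "\<not> adj a e" "\<not> adj b e"
      using ne[of t a b] ne[of a t b] ne[of b t a] t tU d(1) abB adj_sym by blast+
    then have "hammer_in U" using nd t(2-6) d(3) tU dU e eU
      by (intro hammerI[of a b t d e]) (auto simp: adj_commute)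
    then show False using assms by blast
  qed
qed

end

section \<open>Minimal imperfect graphs and weighted partitions\<close>

context simple_graph
begin

definition clique_weight :: "('a \<Rightarrow> nat) \<Rightarrow> 'a set \<Rightarrow> nat" where
  "clique_weight w U = Max (sum w ` {K. K \<subseteq> U \<and> is_clique K})"

definition omega :: "'a set \<Rightarrow> nat" where
  "omega U = Max (card ` {K. K \<subseteq> U \<and> is_clique K})"

definition colorable :: "nat \<Rightarrow> 'a set \<Rightarrow> bool" where
  "colorable k U \<longleftrightarrow>
     (\<exists>c::'a \<Rightarrow> nat. (\<forall>v\<in>U. c v < k) \<and> (\<forall>u\<in>U. \<forall>v\<in>U. adj u v \<longrightarrow> c u \<noteq> c v))"

text \<open>Colouring with \<open>omega D\<close> colours replaces equality of chromatic and clique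
  number; \<open>Least_colorable_eq_omega\<close> reconciles the two for finite sets.\<close>

definition perfect_on :: "'a set \<Rightarrow> bool" where
  "perfect_on U \<longleftrightarrow> (\<forall>D\<subseteq>U. colorable (omega D) D)"

definition min_imperfect :: "'a set \<Rightarrow> bool" where
  "min_imperfect C \<longleftrightarrow> \<not> colorable (omega C) C \<and> (\<forall>D. D \<subset> C \<longrightarrow> perfect_on D)"

lemma is_clique_subset: "is_clique K \<Longrightarrow> L \<subseteq> K \<Longrightarrow> is_clique L"
  unfolding is_clique_def by blast

lemma is_clique_insert: "is_clique K \<Longrightarrow> (\<And>u. u \<in> K \<Longrightarrow> adj v u) \<Longrightarrow> is_clique (insert v K)"
  unfolding is_clique_def using adj_sym by blast

lemma is_clique_empty [simp]: "is_clique {}"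
  by (simp add: is_clique_def)

lemma finite_cliques: "finite U \<Longrightarrow> finite {K. K \<subseteq> U \<and> is_clique K}"
  by (rule finite_subset[of _ "Pow U"]) auto

lemma clique_weight_ge:
  assumes "finite U" "K \<subseteq> U" "is_clique K"
  shows "sum w K \<le> clique_weight w U"
  unfolding clique_weight_def using assms finite_cliques by (intro Max_ge) auto

lemma clique_weight_attained:
  assumes "finite U"
  obtains K where "K \<subseteq> U" "is_clique K" "sum w K = clique_weight w U"
proof -
  have "clique_weight w U \<in> sum w ` {K. K \<subseteq> U \<and> is_clique K}"
    unfolding clique_weight_def using assms finite_cliques
    by (intro Max_in) (auto intro: exI[of _ "{}"])
  then show ?thesis using that by auto
qed

lemma omega_eq: "omega U = clique_weight (\<lambda>_. 1) U"
  by (simp add: omega_def clique_weight_def)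

lemma card_le_omega:
  assumes "finite U" "K \<subseteq> U" "is_clique K"
  shows "card K \<le> omega U"
  using clique_weight_ge[OF assms, of "\<lambda>_. 1"] by (simp add: omega_eq)

lemma omega_attained:
  assumes "finite U"
  obtains K where "K \<subseteq> U" "is_clique K" "card K = omega U"
  using clique_weight_attained[OF assms, of "\<lambda>_. 1"] by (auto simp: omega_eq)

lemma omega_mono:
  assumes "finite U" "D \<subseteq> U"
  shows "omega D \<le> omega U"
proof -
  obtain K where "K \<subseteq> D" "is_clique K" "card K = omega D"
    using omega_attained[of D] assms finite_subset by metis
  then show ?thesis using card_le_omega[OF assms(1), of K] assms by auto
qed

lemma colorable_mono: "colorable k U \<Longrightarrow> k \<le> m \<Longrightarrow> colorable m U"
  unfolding colorable_def using order_less_le_trans by meson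

lemma perfect_on_subset: "perfect_on U \<Longrightarrow> D \<subseteq> U \<Longrightarrow> perfect_on D"
  unfolding perfect_on_def by blast

text \<open>
  A colouring form of Lovasz's replication lemma: \<open>x0\<close> receives a set \<open>F\<close> of \<open>k\<close> colours. To pass
  from \<open>k\<close> to \<open>k + 1\<close>, delete from \<open>Y\<close> the vertices sharing one colour of \<open>F\<close>, colour the rest again
  with one colour less, and give the new colour to the deleted vertices and to \<open>x0\<close>.
\<close>
lemma perfect_replicate:
  assumes "finite Y" "x0 \<notin> Y" "perfect_on (insert x0 Y)" "1 \<le> k"
    and "\<And>K. \<lbrakk>K \<subseteq> Y; is_clique K\<rbrakk> \<Longrightarrow> card K \<le> m"
    and "\<And>K. \<lbrakk>K \<subseteq> Y; is_clique K; \<forall>v\<in>K. adj x0 v\<rbrakk> \<Longrightarrow> card K + k \<le> m"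
  shows "\<exists>(c::'a \<Rightarrow> nat) F. (\<forall>y\<in>Y. c y < m) \<and> (\<forall>u\<in>Y. \<forall>v\<in>Y. adj u v \<longrightarrow> c u \<noteq> c v) \<and>
    F \<subseteq> {..<m} \<and> card F = k \<and> (\<forall>y\<in>Y. adj x0 y \<longrightarrow> c y \<notin> F)"
  using assms(4,1,2,3,5,6)
proof (induction k arbitrary: Y m rule: dec_induct)
  case base
  \<comment> \<open>For \<open>k = 1\<close> the two clique bounds cover the cliques avoiding and
    containing \<open>x0\<close>; \<open>F\<close> will consist of the colour of
    \<open>x0\<close>.\<close>
  have "omega (insert x0 Y) \<le> m"
  proof -
    obtain K where K: "K \<subseteq> insert x0 Y" "is_clique K" "card K = omega (insert x0 Y)"
      using omega_attained[of "insert x0 Y"] base.prems(1) by auto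
    show ?thesis
    proof (cases "x0 \<in> K")
      case False
      then have "K \<subseteq> Y" using K(1) by (simp add: subset_insert)
      then have "card K \<le> m" using base.prems(4) K(2) by blast
      then show ?thesis unfolding K(3) .
    next
      case True
      have "\<forall>v\<in>K - {x0}. adj x0 v" using K(2) True by (auto simp: is_clique_def)
      then have "card (K - {x0}) + 1 \<le> m"
        using base.prems(5)[of "K - {x0}"] K is_clique_subset[OF K(2)] by blast
      moreover have "finite K" using K(1) base.prems(1) finite_subset by blast
      ultimately show ?thesis using K(3) True card_Suc_Diff1[of K x0] by simp
    qed
  qed
  then have "colorable m (insert x0 Y)"
    using base.prems(3) colorable_mono unfolding perfect_on_def by blast
  then obtain c :: "'a \<Rightarrow> nat" where "\<forall>v\<in>insert x0 Y. c v < m"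
    "\<forall>u\<in>insert x0 Y. \<forall>v\<in>insert x0 Y. adj u v \<longrightarrow> c u \<noteq> c v"
    unfolding colorable_def by blast
  then show ?case by (intro exI[of _ c] exI[of _ "{c x0}"]) auto
next
  case (step k)
  have bound: "card K + k \<le> m" if "K \<subseteq> Y" "is_clique K" "\<forall>v\<in>K. adj x0 v" for K
    using step.prems(5)[OF that] by simp
  obtain c :: "'a \<Rightarrow> nat" and F where c: "\<forall>y\<in>Y. c y < m" "\<forall>u\<in>Y. \<forall>v\<in>Y. adj u v \<longrightarrow> c u \<noteq> c v"
    "F \<subseteq> {..<m}" "card F = k" "\<forall>y\<in>Y. adj x0 y \<longrightarrow> c y \<notin> F"
    using step.IH[OF step.prems(1-4) bound] by blast
  obtain col where col: "col \<in> F" using c(4) step.hyps(1) by fastforce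
  define Z where "Z = {y\<in>Y. c y \<noteq> col}"
  have ZY: "Z \<subseteq> Y" by (auto simp: Z_def)
  \<comment> \<open>Colour \<open>col\<close> does not occur on \<open>Z\<close>, so a clique of
    \<open>Z\<close> uses at most \<open>m - 1\<close> colours of \<open>c\<close>.\<close>
  have "card K \<le> m - 1" if K: "K \<subseteq> Z" "is_clique K" for K
  proof -
    have "inj_on c K" using c(2) K ZY unfolding inj_on_def is_clique_def by blast
    moreover have "c ` K \<subseteq> {..<m} - {col}" using c(1) K by (auto simp: Z_def)
    ultimately have "card K \<le> card ({..<m} - {col})" by (intro card_inj_on_le) auto
    then show ?thesis using col c(3) by auto
  qed
  moreover have "card K + k \<le> m - 1" if "K \<subseteq> Z" "is_clique K" "\<forall>v\<in>K. adj x0 v" for K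
    using step.prems(5)[of K] that ZY by fastforce
  moreover have "finite Z" "x0 \<notin> Z" "perfect_on (insert x0 Z)"
    using step.prems(1-3) ZY finite_subset perfect_on_subset[of "insert x0 Y" "insert x0 Z"] by blast+
  ultimately obtain d :: "'a \<Rightarrow> nat" and G where d: "\<forall>y\<in>Z. d y < m - 1"
    "\<forall>u\<in>Z. \<forall>v\<in>Z. adj u v \<longrightarrow> d u \<noteq> d v" "G \<subseteq> {..<m - 1}" "card G = k" "\<forall>y\<in>Z. adj x0 y \<longrightarrow> d y \<notin> G"
    using step.IH[of Z "m - 1"] by blast
  have m: "0 < m" using col c(3) by auto
  have fG: "finite G" using d(3) finite_subset by blast
  have mG: "m - 1 \<notin> G" using d(3) by auto
  define e where "e y = (if y \<in> Z then d y else m - 1)" for y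
  have "\<forall>y\<in>Y. e y < m" using d(1) m by (fastforce simp: e_def)
  moreover have "\<forall>u\<in>Y. \<forall>v\<in>Y. adj u v \<longrightarrow> e u \<noteq> e v"
  proof (intro ballI impI)
    fix u v assume uv: "u \<in> Y" "v \<in> Y" "adj u v"
    have "u \<in> Z \<or> v \<in> Z" using c(2) uv unfolding Z_def by (metis (mono_tags, lifting) mem_Collect_eq)
    then show "e u \<noteq> e v" using d(1,2) uv(3) unfolding e_def by (metis nat_neq_iff)
  qed
  moreover have "insert (m - 1) G \<subseteq> {..<m}" using d(3) m by fastforce
  moreover have "card (insert (m - 1) G) = Suc k" using fG mG d(4) by simp
  moreover have "\<forall>y\<in>Y. adj x0 y \<longrightarrow> e y \<notin> insert (m - 1) G"
  proof (intro ballI impI)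
    fix y assume y: "y \<in> Y" "adj x0 y"
    \<comment> \<open>A neighbour of \<open>x0\<close> avoids the colours of \<open>F\<close>, in
      particular \<open>col\<close>, and so was not deleted.\<close>
    then have "y \<in> Z" using c(5) col unfolding Z_def by blast
    then show "e y \<notin> insert (m - 1) G" using d(1,5) y unfolding e_def by fastforce
  qed
  ultimately show ?case by blast
qed

text \<open>Lovasz's substitution lemma: give \<open>x0\<close> a set \<open>F\<close> of
  \<open>omega X\<close> colours by \<open>perfect_replicate\<close> and colour \<open>X\<close>
  from \<open>F\<close>. \<open>x0\<close> may lie outside \<open>X\<close>, as happens when
  \<open>perfect_on_substitution\<close> passes to subsets.\<close>

lemma colorable_substitution:
  assumes "finite Y" "finite X" "x0 \<notin> Y" "perfect_on (insert x0 Y)" "perfect_on X" "X \<inter> Y = {}"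
    and hom: "\<And>x y. \<lbrakk>x \<in> X; y \<in> Y\<rbrakk> \<Longrightarrow> adj x y \<longleftrightarrow> adj x0 y"
  shows "colorable (omega (Y \<union> X)) (Y \<union> X)"
proof (cases "X = {}")
  case True
  then show ?thesis using assms(4) unfolding perfect_on_def by auto
next
  case False
  define m where "m = omega (Y \<union> X)"
  define k where "k = omega X"
  have fin: "finite (Y \<union> X)" using assms by blast
  obtain KX where KX: "KX \<subseteq> X" "is_clique KX" "card KX = k"
    using omega_attained[OF assms(2)] k_def by metis
  obtain x1 where "x1 \<in> X" using False by blast
  then have "card {x1} \<le> k" unfolding k_def using assms(2)
    by (intro card_le_omega) (auto simp: is_clique_def)
  then have "1 \<le> k" by simp
  moreover have "card K \<le> m" if "K \<subseteq> Y" "is_clique K" for K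
    unfolding m_def using card_le_omega[OF fin, of K] that by blast
  \<comment> \<open>A clique among the neighbours of \<open>x0\<close> in \<open>Y\<close> joins
    with a maximum clique \<open>KX\<close> of \<open>X\<close>.\<close>
  moreover have "card K + k \<le> m" if K: "K \<subseteq> Y" "is_clique K" "\<forall>v\<in>K. adj x0 v" for K
  proof -
    have "adj x v" "adj v x" if "x \<in> KX" "v \<in> K" for x v
      using hom[of x v] that K KX adj_sym by blast+
    then have "is_clique (K \<union> KX)"
      using K(2) KX(2) unfolding is_clique_def by blast
    then have "card (K \<union> KX) \<le> m"
      unfolding m_def using K(1) KX(1) by (intro card_le_omega[OF fin]) auto
    moreover have "K \<inter> KX = {}" "finite K" "finite KX"
      using K(1) KX(1) assms(1,2,6) finite_subset by blast+
    ultimately show ?thesis using KX(3) by (simp add: card_Un_disjoint)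
  qed
  ultimately obtain c :: "'a \<Rightarrow> nat" and F where c: "\<forall>y\<in>Y. c y < m"
    "\<forall>u\<in>Y. \<forall>v\<in>Y. adj u v \<longrightarrow> c u \<noteq> c v" "F \<subseteq> {..<m}" "card F = k" "\<forall>y\<in>Y. adj x0 y \<longrightarrow> c y \<notin> F"
    using perfect_replicate[OF assms(1,3,4), of k m] by blast
  obtain d :: "'a \<Rightarrow> nat" where d: "\<forall>v\<in>X. d v < k" "\<forall>u\<in>X. \<forall>v\<in>X. adj u v \<longrightarrow> d u \<noteq> d v"
    using assms(5) unfolding perfect_on_def colorable_def k_def by blast
  have "finite F" using c(3) finite_subset by blast
  then obtain g where g: "bij_betw g {..<k} F"
    using c(4) by (metis card_lessThan finite_lessThan finite_same_card_bij)
  define e where "e v = (if v \<in> X then g (d v) else c v)" for v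
  have gF: "g (d v) \<in> F" if "v \<in> X" for v
    using g d(1) that bij_betwE by blast
  have gne: "g (d u) \<noteq> g (d v)" if "u \<in> X" "v \<in> X" "adj u v" for u v
    using g d that unfolding bij_betw_def inj_on_def by blast
  have "\<forall>v\<in>Y \<union> X. e v < m"
    using c(1,3) gF unfolding e_def by auto
  moreover have "e u \<noteq> e v" if uv: "u \<in> Y \<union> X" "v \<in> Y \<union> X" "adj u v" for u v
  proof -
    have *: "g (d x) \<noteq> c y" if "x \<in> X" "y \<in> Y" "adj x y" for x y
      using hom[of x y] that c(5) gF[of x] by metis
    have vu: "adj v u" using uv(3) adj_sym by blast
    consider "u \<in> X" "v \<in> X" | "u \<in> X" "v \<in> Y" "v \<notin> X" | "u \<in> Y" "u \<notin> X" "v \<in> X"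
      | "u \<in> Y" "u \<notin> X" "v \<in> Y" "v \<notin> X" using uv(1,2) by blast
    then show ?thesis
    proof cases
      case 1 then show ?thesis using gne uv(3) by (simp add: e_def)
    next
      case 2 then show ?thesis using *[of u v] uv(3) by (simp add: e_def)
    next
      case 3 then show ?thesis using *[of v u] vu by (simp add: e_def)
    next
      case 4 then show ?thesis using c(2) uv(3) by (simp add: e_def)
    qed
  qed
  ultimately show ?thesis unfolding colorable_def m_def by blast
qed

lemma perfect_on_substitution:
  assumes "finite Y" "finite X" "x0 \<notin> Y" "perfect_on (insert x0 Y)" "perfect_on X" "X \<inter> Y = {}"
    and hom: "\<And>x y. \<lbrakk>x \<in> X; y \<in> Y\<rbrakk> \<Longrightarrow> adj x y \<longleftrightarrow> adj x0 y"
  shows "perfect_on (Y \<union> X)"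
  unfolding perfect_on_def
proof (intro allI impI)
  fix D assume "D \<subseteq> Y \<union> X"
  then have "D = (D \<inter> Y) \<union> (D \<inter> X)" by blast
  moreover have "colorable (omega ((D \<inter> Y) \<union> (D \<inter> X))) ((D \<inter> Y) \<union> (D \<inter> X))"
  proof (rule colorable_substitution[of _ _ x0])
    show "perfect_on (insert x0 (D \<inter> Y))" by (rule perfect_on_subset[OF assms(4)]) blast
    show "perfect_on (D \<inter> X)" by (rule perfect_on_subset[OF assms(5)]) blast
  qed (use assms in auto)
  ultimately show "colorable (omega D) D" by simp
qed

section \<open>Minimal imperfect sets\<close>

lemma min_imperfect_exists:
  assumes "finite U" "\<not> perfect_on U"
  obtains C where "C \<subseteq> U" "min_imperfect C"
proof -
  have "\<exists>C\<subseteq>U. min_imperfect C"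
    using assms
  proof (induction "card U" arbitrary: U rule: less_induct)
    case less
    show ?case
    proof (cases "\<forall>D. D \<subset> U \<longrightarrow> perfect_on D")
      case True
      moreover have "\<not> colorable (omega U) U"
        using less.prems(2) True unfolding perfect_on_def by (metis order_refl psubsetI)
      ultimately show ?thesis unfolding min_imperfect_def by blast
    next
      case False
      then obtain D where D: "D \<subset> U" "\<not> perfect_on D" by blast
      then have "card D < card U" "finite D" using less.prems psubset_card_mono finite_subset by blast+
      then show ?thesis using less.hyps[of D] D by blast
    qed
  qed
  then show ?thesis using that by blast
qed

lemma min_imperfect_del:
  assumes "min_imperfect C" "s \<in> C" "finite C"
  obtains c :: "'a \<Rightarrow> nat" where "\<forall>v\<in>C - {s}. c v < omega C"
    "\<forall>u\<in>C - {s}. \<forall>v\<in>C - {s}. adj u v \<longrightarrow> c u \<noteq> c v"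
proof -
  have "perfect_on (C - {s})" using assms unfolding min_imperfect_def by blast
  then have "colorable (omega (C - {s})) (C - {s})" unfolding perfect_on_def by blast
  then have "colorable (omega C) (C - {s})" using colorable_mono omega_mono[OF assms(3), of "C - {s}"] by blast
  then show ?thesis using that unfolding colorable_def by blast
qed

text \<open>If colour \<open>k\<close> were missing around \<open>s\<close>, giving it to
  \<open>s\<close> would colour all of \<open>C\<close> with \<open>omega C\<close> colours.\<close>

lemma min_imperfect_recolor:
  assumes "min_imperfect C" "s \<in> C"
    and "\<forall>v\<in>C - {s}. c v < omega C" "\<forall>u\<in>C - {s}. \<forall>v\<in>C - {s}. adj u v \<longrightarrow> c u \<noteq> c v"
    and "k < omega C"
  obtains t where "t \<in> C" "adj s t" "c t = k"
proof (rule ccontr)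
  assume "\<not> thesis"
  then have no: "c t \<noteq> k" if "t \<in> C" "adj s t" for t using that \<open>\<And>t. \<lbrakk>t \<in> C; adj s t; c t = k\<rbrakk> \<Longrightarrow> thesis\<close> by blast
  have "\<forall>v\<in>C. (c(s := k)) v < omega C" using assms by auto
  moreover have "(c(s := k)) u \<noteq> (c(s := k)) v" if "u \<in> C" "v \<in> C" "adj u v" for u v
    using that assms(4) no[of u] no[of v] adj_sym[of u v] by (cases "u = s"; cases "v = s") auto
  ultimately have "colorable (omega C) C" unfolding colorable_def by blast
  then show False using assms unfolding min_imperfect_def by blast
qed

text \<open>All \<open>omega C\<close> colours occur on the neighbours of \<open>s\<close>; if these
  formed a clique, adding \<open>s\<close> would exceed \<open>omega C\<close>.\<close>

lemma min_imperfect_no_simplicial: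
  assumes "min_imperfect C" "s \<in> C" "finite C"
  shows "\<not> is_clique {t\<in>C. adj s t}"
proof
  assume cl: "is_clique {t\<in>C. adj s t}"
  obtain c :: "'a \<Rightarrow> nat" where c: "\<forall>v\<in>C - {s}. c v < omega C"
    "\<forall>u\<in>C - {s}. \<forall>v\<in>C - {s}. adj u v \<longrightarrow> c u \<noteq> c v"
    using min_imperfect_del[OF assms] by blast
  have "{..<omega C} \<subseteq> c ` {t\<in>C. adj s t}"
    using min_imperfect_recolor[OF assms(1,2) c] by (smt (verit) image_eqI lessThan_iff mem_Collect_eq subsetI)
  moreover have fin: "finite {t\<in>C. adj s t}" using assms by auto
  ultimately have "card {..<omega C} \<le> card {t\<in>C. adj s t}" by (rule surj_card_le[rotated])
  moreover have "card (insert s {t\<in>C. adj s t}) \<le> omega C"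
    using assms cl by (intro card_le_omega is_clique_insert) auto
  ultimately show False using fin by simp
qed

lemma min_imperfect_nonempty:
  assumes "min_imperfect C"
  shows "C \<noteq> {}"
  using assms unfolding min_imperfect_def colorable_def by auto

text \<open>A nonempty split graph has a simplicial vertex: any member of the stable part or, if
  that part is empty, any vertex.\<close>

lemma min_imperfect_not_split:
  assumes "min_imperfect C" "finite C"
  shows "\<not> split C"
proof
  assume "split C"
  then obtain K S where KS: "C = K \<union> S" "is_clique K" "is_stable S" unfolding split_def by blast
  have "\<exists>s\<in>C. is_clique {t\<in>C. adj s t}"
  proof (cases "S = {}")
    case True
    obtain s where "s \<in> C" using min_imperfect_nonempty[OF assms(1)] by blast
    moreover have "is_clique {t\<in>C. adj s t}" by (rule is_clique_subset[OF KS(2)]) (use True KS in auto)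
    ultimately show ?thesis by blast
  next
    case False
    then obtain s where "s \<in> S" by blast
    then have "{t\<in>C. adj s t} \<subseteq> K" using KS unfolding is_stable_def by blast
    then have "is_clique {t\<in>C. adj s t}" by (rule is_clique_subset[OF KS(2)])
    then show ?thesis using \<open>s \<in> S\<close> KS by blast
  qed
  then show False using min_imperfect_no_simplicial assms by blast
qed

text \<open>After colouring \<open>C - {s}\<close>, the colour of \<open>y\<close> recurs on a
  neighbour \<open>t\<close> of \<open>s\<close>, and equal colours make \<open>t\<close> and
  \<open>y\<close> non-adjacent.\<close>

lemma min_imperfect_no_domination:
  assumes "min_imperfect C" "finite C"
  shows "no_domination C"
  unfolding no_domination_def
proof (intro ballI impI)
  fix s y assume sy: "s \<in> C" "y \<in> C" "s \<noteq> y \<and> \<not> adj s y"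
  obtain c :: "'a \<Rightarrow> nat" where c: "\<forall>v\<in>C - {s}. c v < omega C"
    "\<forall>u\<in>C - {s}. \<forall>v\<in>C - {s}. adj u v \<longrightarrow> c u \<noteq> c v"
    using min_imperfect_del[OF assms(1) sy(1) assms(2)] by blast
  have "c y < omega C" using c sy by auto
  then obtain t where t: "t \<in> C" "adj s t" "c t = c y"
    using min_imperfect_recolor[OF assms(1) sy(1) c] by blast
  then have "t \<noteq> s" by auto
  then have "\<not> adj y t" using c(2) t sy by (metis DiffI singletonD)
  then show "\<exists>t\<in>C. adj s t \<and> \<not> adj y t" using t by blast
qed

text \<open>For a homogeneous \<open>X\<close>, both \<open>X\<close> and \<open>C\<close> with
  \<open>X\<close> contracted to \<open>p\<close> are perfect as proper subsets, so substitution
  would colour \<open>C\<close>.\<close>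

lemma min_imperfect_prime:
  assumes "min_imperfect C" "finite C"
  shows "prime_on C"
  unfolding prime_on_def
proof (intro allI impI, rule ccontr)
  fix X assume X: "X \<subset> C" "\<exists>p\<in>X. \<exists>q\<in>X. p \<noteq> q"
    and no: "\<not> (\<exists>w\<in>C - X. \<exists>p\<in>X. \<exists>q\<in>X. adj w p \<and> \<not> adj w q)"
  obtain p q where pq: "p \<in> X" "q \<in> X" "p \<noteq> q" using X by blast
  have "colorable (omega ((C - X) \<union> X)) ((C - X) \<union> X)"
  proof (rule colorable_substitution[of _ _ p])
    have "insert p (C - X) \<subseteq> C" "q \<in> C" "q \<notin> insert p (C - X)" using X(1) pq by auto
    then have "insert p (C - X) \<subset> C" by auto
    then show "perfect_on (insert p (C - X))" using assms unfolding min_imperfect_def by blast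
    show "perfect_on X" using assms X unfolding min_imperfect_def by blast
    show "adj x y \<longleftrightarrow> adj p y" if "x \<in> X" "y \<in> C - X" for x y
      using no that pq adj_commute by blast
  qed (use assms X pq finite_subset in auto)
  moreover have "(C - X) \<union> X = C" using X by blast
  ultimately show False using assms unfolding min_imperfect_def by simp
qed

section \<open>Weighted partitions and contraction of homogeneous sets\<close>

definition weight_divisible :: "('a \<Rightarrow> nat) \<Rightarrow> 'a set \<Rightarrow> bool" where
  "weight_divisible w U \<longleftrightarrow> (\<exists>P W. P \<union> W = U \<and> P \<inter> W = {} \<and> perfect_on P \<and>
     clique_weight w W < clique_weight w U)"

text \<open>The neighbours of \<open>v\<close> serve as \<open>W\<close>: each clique among them
  extends by \<open>v\<close>, which has positive weight. \<open>v\<close> itself belongs to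
  \<open>P\<close>.\<close>

lemma weight_divisible_nonneighbours:
  assumes "finite U" "v \<in> U" "0 < w v" "perfect_on {u\<in>U. \<not> adj v u}"
  shows "weight_divisible w U"
proof -
  obtain K where K: "K \<subseteq> {u\<in>U. adj v u}" "is_clique K" "sum w K = clique_weight w {u\<in>U. adj v u}"
    using clique_weight_attained[of "{u\<in>U. adj v u}" w] assms(1) by auto
  have "sum w (insert v K) \<le> clique_weight w U"
    using assms K by (intro clique_weight_ge is_clique_insert) auto
  moreover have "v \<notin> K" "finite K" using K(1) assms(1) finite_subset[of K U] by auto
  ultimately have "clique_weight w {u\<in>U. adj v u} < clique_weight w U"
    using K(3) assms(3) by simp
  then show ?thesis unfolding weight_divisible_def
    using assms(4) by (intro exI[of _ "{u\<in>U. \<not> adj v u}"] exI[of _ "{u\<in>U. adj v u}"]) auto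
qed

text \<open>Contract \<open>X\<close> to \<open>p\<close> with weight
  \<open>clique_weight w X\<close> and lift a partition of the smaller set. The hypothesis
  \<open>proper\<close> ranges over all weights because the contracted set carries \<open>w'\<close>
  rather than \<open>w\<close>.\<close>

lemma weight_divisible_homogeneous:
  assumes fin: "finite U" and X: "X \<subset> U" "p \<in> X" "q \<in> X" "p \<noteq> q"
    and hom: "\<And>x y. \<lbrakk>x \<in> X; y \<in> U - X\<rbrakk> \<Longrightarrow> adj x y \<longleftrightarrow> adj p y"
    and proper: "\<And>D w. \<lbrakk>D \<subset> U; D \<noteq> {}; \<forall>v\<in>D. 0 < w v\<rbrakk> \<Longrightarrow> weight_divisible w D"
    and w: "\<forall>v\<in>U. 0 < w v"
  shows "weight_divisible w U"
proof -
  define Y where "Y = U - X"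
  define w' where "w' = w(p := clique_weight w X)"
  have fX: "finite X" and fY: "finite Y" using fin X finite_subset unfolding Y_def by auto
  have pY: "p \<notin> Y" using X unfolding Y_def by blast
  have "insert p Y \<subseteq> U" "q \<in> U" "q \<notin> insert p Y" using X unfolding Y_def by auto
  then have DU: "insert p Y \<subset> U" by auto
  have w'Y: "sum w' K = sum w K" if "K \<subseteq> Y" for K
    using that pY unfolding w'_def by (intro sum.cong) auto
  have "sum w {p} \<le> clique_weight w X" using fX X by (intro clique_weight_ge) (auto simp: is_clique_def)
  moreover have "0 < w p" using w X by blast
  ultimately have "0 < clique_weight w X" by simp
  then have "\<forall>v\<in>insert p Y. 0 < w' v" using w unfolding w'_def Y_def by auto
  then have "weight_divisible w' (insert p Y)" using proper DU by blast
  then obtain P' W' where PW': "P' \<union> W' = insert p Y" "P' \<inter> W' = {}" "perfect_on P'"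
      "clique_weight w' W' < clique_weight w' (insert p Y)"
    unfolding weight_divisible_def by blast
  have w'p: "sum w' (insert p K) = sum w K + clique_weight w X" if "K \<subseteq> Y" for K
  proof -
    have "p \<notin> K" "finite K" using that pY fY finite_subset by blast+
    then show ?thesis using w'Y[OF that] by (simp add: w'_def)
  qed
  have split_sum: "sum w K = sum w (K - X) + sum w (K \<inter> X)" if "K \<subseteq> U" for K
    using sum.Int_Diff[of K w X] that fin finite_subset by (metis add.commute)
  have clique_p: "is_clique (insert p (K - X))" if K: "K \<subseteq> U" "is_clique K" "K \<inter> X \<noteq> {}" for K
  proof (rule is_clique_insert)
    show "is_clique (K - X)" using is_clique_subset K by blast
    fix u assume u: "u \<in> K - X"
    obtain x where x: "x \<in> K" "x \<in> X" using K(3) by auto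
    moreover have "x \<noteq> u" using x u by auto
    ultimately have "adj x u" using K(2) u unfolding is_clique_def by auto
    moreover have "u \<in> U - X" using u K(1) by auto
    ultimately show "adj p u" using hom x by simp
  qed
  \<comment> \<open>Expanding \<open>p\<close> into a heaviest clique of \<open>X\<close> turns a
    clique of the contracted set into one of \<open>U\<close> of the same weight.\<close>
  have upper: "clique_weight w' (insert p Y) \<le> clique_weight w U"
  proof -
    obtain K where K: "K \<subseteq> insert p Y" "is_clique K" "sum w' K = clique_weight w' (insert p Y)"
      using clique_weight_attained[of "insert p Y" w'] fY by auto
    obtain L where L: "L \<subseteq> X" "is_clique L" "sum w L = clique_weight w X"
      using clique_weight_attained[OF fX] by blast
    show ?thesis
    proof (cases "p \<in> K")
      case False
      then have "K \<subseteq> Y" using K(1) by (simp add: subset_insert)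
      moreover have "sum w K \<le> clique_weight w U"
        using fin K(2) \<open>K \<subseteq> Y\<close> Y_def by (intro clique_weight_ge) auto
      ultimately show ?thesis using K(3) w'Y by simp
    next
      case True
      define K1 where "K1 = K - {p}"
      have K1: "K = insert p K1" "K1 \<subseteq> Y" using True K(1) by (auto simp: K1_def)
      have "adj p y" if "y \<in> K1" for y using that K(2) True by (auto simp: K1_def is_clique_def)
      then have "adj x y" "adj y x" if "x \<in> L" "y \<in> K1" for x y
        using hom[of x y] that L(1) K1(2) adj_sym unfolding Y_def by blast+
      moreover have "is_clique K1" using K(2) is_clique_subset K1 by blast
      ultimately have "is_clique (K1 \<union> L)" using L(2) unfolding is_clique_def by blast
      then have "sum w (K1 \<union> L) \<le> clique_weight w U"
        using K1(2) L(1) X(1) by (intro clique_weight_ge[OF fin]) (auto simp: Y_def)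
      moreover have "K1 \<inter> L = {}" "finite K1" "finite L"
        using K1(2) L(1) fX fY finite_subset unfolding Y_def by blast+
      then have "sum w (K1 \<union> L) = sum w K1 + sum w L" by (rule sum.union_disjoint[rotated 2])
      ultimately show ?thesis using K(3) L(3) w'p[OF K1(2)] K1(1) by simp
    qed
  qed
  show ?thesis
  proof (cases "p \<in> W'")
    case True
    \<comment> \<open>When \<open>p\<close> is in \<open>W'\<close>, all of \<open>X\<close>
      replaces it; contracting a clique of \<open>W\<close> back to \<open>p\<close> does not
      decrease its weight.\<close>
    define W where "W = (W' - {p}) \<union> X"
    have WU: "W \<subseteq> U" using PW'(1) X(1) unfolding W_def Y_def by blast
    then have fW: "finite W" using fin finite_subset by blast
    have fW': "finite W'" using PW'(1) fY by (metis finite_Un finite_insert)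
    obtain K where K: "K \<subseteq> W" "is_clique K" "sum w K = clique_weight w W"
      using clique_weight_attained[OF fW] by blast
    have KX: "K - X \<subseteq> Y" "K - X \<subseteq> W'" "K \<subseteq> U" using K(1) WU unfolding W_def Y_def by blast+
    have "sum w K \<le> clique_weight w' W'"
    proof (cases "K \<inter> X = {}")
      case True
      then have "K - X = K" by blast
      then show ?thesis using clique_weight_ge[OF fW', of K w'] K(2) KX w'Y[of K] by simp
    next
      case False
      have "sum w' (insert p (K - X)) \<le> clique_weight w' W'"
        using clique_p[OF KX(3) K(2) False] KX(2) True by (intro clique_weight_ge[OF fW']) auto
      moreover have "sum w (K \<inter> X) \<le> clique_weight w X"
        using K(2) is_clique_subset by (intro clique_weight_ge[OF fX]) blast+
      ultimately show ?thesis using w'p[OF KX(1)] split_sum[OF KX(3)] by simp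
    qed
    then have "clique_weight w W < clique_weight w U" using K(3) PW'(4) upper by simp
    moreover have "P' = insert p Y - W'" "W' \<subseteq> insert p Y" using PW'(1,2) by auto
    then have "P' \<union> W = U" "P' \<inter> W = {}" using True X(1,2) by (auto simp: W_def Y_def)
    ultimately show ?thesis using PW'(3) unfolding weight_divisible_def by blast
  next
    case False
    then have pP': "p \<in> P'" using PW'(1) by blast
    \<comment> \<open>When \<open>p\<close> is in \<open>P'\<close>, \<open>X\<close> must be
      partitioned as well: \<open>PX\<close> replaces \<open>p\<close> in the perfect part and
      \<open>WX\<close> joins \<open>W'\<close>.\<close>
    have "weight_divisible w X" using proper[of X w] X w by blast
    then obtain PX WX where PWX: "PX \<union> WX = X" "PX \<inter> WX = {}" "perfect_on PX"
        "clique_weight w WX < clique_weight w X"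
      unfolding weight_divisible_def by blast
    define P where "P = (P' - {p}) \<union> PX"
    define W where "W = W' \<union> WX"
    have sub: "P' - {p} \<subseteq> Y" "W' \<subseteq> Y" using PW'(1) False by auto
    have perf: "perfect_on P" unfolding P_def
    proof (rule perfect_on_substitution[of _ _ p])
      show "perfect_on (insert p (P' - {p}))" using PW'(3) pP' by (simp add: insert_absorb)
      show "finite (P' - {p})" using sub(1) fY finite_subset by blast
      show "finite PX" using PWX(1) fX by (metis finite_Un)
      show "PX \<inter> (P' - {p}) = {}" using sub PWX(1) unfolding Y_def by blast
      show "adj x y \<longleftrightarrow> adj p y" if "x \<in> PX" "y \<in> P' - {p}" for x y
        using hom that sub PWX(1) unfolding Y_def by blast
    qed (use PWX in auto)
    have WU: "W \<subseteq> U" using sub PWX(1) X unfolding W_def Y_def by blast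
    have fW': "finite W'" using sub fY finite_subset by blast
    obtain K where K: "K \<subseteq> W" "is_clique K" "sum w K = clique_weight w W"
      using clique_weight_attained[of W w] WU fin finite_subset by blast
    have KX: "K - X \<subseteq> Y" "K - X \<subseteq> W'" "K \<inter> X \<subseteq> WX" "K \<subseteq> U"
      using K(1) WU PWX(1) sub unfolding W_def Y_def by blast+
    have fWX: "finite WX" using PWX(1) fX by (metis finite_Un)
    \<comment> \<open>Strictness comes from \<open>W'\<close> if \<open>K\<close> avoids
      \<open>X\<close>, and from \<open>WX\<close> being lighter than \<open>X\<close>
      otherwise.\<close>
    have "sum w K < clique_weight w' (insert p Y)"
    proof (cases "K \<inter> X = {}")
      case True
      then have "K - X = K" by blast
      then show ?thesis using clique_weight_ge[OF fW', of K w'] K(2) KX w'Y[of K] PW'(4) by simp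
    next
      case False
      have "sum w' (insert p (K - X)) \<le> clique_weight w' (insert p Y)"
        using clique_p[OF KX(4) K(2) False] KX(1) fY by (intro clique_weight_ge) auto
      moreover have "sum w (K \<inter> X) \<le> clique_weight w WX"
        using K(2) is_clique_subset KX(3) by (intro clique_weight_ge[OF fWX]) blast+
      ultimately show ?thesis using w'p[OF KX(1)] split_sum[OF KX(4)] PWX(4) by simp
    qed
    then have "clique_weight w W < clique_weight w U" using K(3) upper by simp
    moreover have "P' - {p} = Y - W'" "W' \<subseteq> Y" "PX = X - WX" "WX \<subseteq> X"
      using PW'(1,2) PWX(1,2) pY pP' sub(2) by auto
    then have "P \<union> W = U" "P \<inter> W = {}" using X(1) by (auto simp: P_def W_def Y_def)
    ultimately show ?thesis using perf unfolding weight_divisible_def by blast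
  qed
qed

section \<open>Minimal counterexamples\<close>

definition triangle_in :: "'a set \<Rightarrow> bool" where
  "triangle_in U \<longleftrightarrow> (\<exists>a\<in>U. \<exists>b\<in>U. \<exists>c\<in>U. adj a b \<and> adj b c \<and> adj a c)"

lemma prime_of_not_weight_divisible:
  assumes "finite U" "\<forall>v\<in>U. 0 < w v" "\<not> weight_divisible w U"
    and proper: "\<And>D w. \<lbrakk>D \<subset> U; D \<noteq> {}; \<forall>v\<in>D. 0 < w v\<rbrakk> \<Longrightarrow> weight_divisible w D"
  shows "prime_on U"
  unfolding prime_on_def
proof (intro allI impI, rule ccontr)
  fix X assume X: "X \<subset> U" "\<exists>p\<in>X. \<exists>q\<in>X. p \<noteq> q"
    and no: "\<not> (\<exists>w\<in>U - X. \<exists>p\<in>X. \<exists>q\<in>X. adj w p \<and> \<not> adj w q)"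
  obtain p q where pq: "p \<in> X" "q \<in> X" "p \<noteq> q" using X(2) by blast
  have "adj x y \<longleftrightarrow> adj p y" if "x \<in> X" "y \<in> U - X" for x y
    using no that pq(1) adj_commute by blast
  then have "weight_divisible w U"
    using weight_divisible_homogeneous[OF assms(1) X(1) pq] proper assms(2) by blast
  then show False using assms(3) by blast
qed

lemma weight_divisible_with_triangle:
  assumes "finite U" "\<forall>v\<in>U. 0 < w v" "\<not> bull_in U" "\<not> house_in U \<or> \<not> hammer_in U" "triangle_in U"
    and proper: "\<And>D w. \<lbrakk>D \<subset> U; D \<noteq> {}; \<forall>v\<in>D. 0 < w v\<rbrakk> \<Longrightarrow> weight_divisible w D"
  shows "weight_divisible w U"
proof (rule ccontr)
  assume nd: "\<not> weight_divisible w U"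
  have prime: "prime_on U"
    using prime_of_not_weight_divisible[OF assms(1,2) nd] proper by blast
  obtain v a b where v: "v \<in> U" "a \<in> U" "b \<in> U" "adj v a" "adj a b" "adj v b"
    using assms(5) unfolding triangle_in_def by blast
  have "\<not> perfect_on {u\<in>U. \<not> adj v u}"
    using weight_divisible_nonneighbours[OF assms(1) v(1)] assms(2) v(1) nd by blast
  moreover have "finite {u\<in>U. \<not> adj v u}" using assms(1) by simp
  ultimately obtain C where C: "C \<subseteq> {u\<in>U. \<not> adj v u}" "min_imperfect C"
    using min_imperfect_exists by blast
  have fC: "finite C" using C(1) assms(1) finite_subset by fastforce
  \<comment> \<open>Inside \<open>C\<close>, \<open>v\<close> would be isolated and therefore
    simplicial.\<close>
  have "v \<notin> C"
  proof
    assume "v \<in> C"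
    moreover have "{t\<in>C. adj v t} = {}" using C(1) by blast
    ultimately show False
      using min_imperfect_no_simplicial[OF C(2) _ fC, of v] is_clique_empty by metis
  qed
  then interpret bull_free_core adj U C v
    using prime assms(3) C v(1) fC min_imperfect_prime min_imperfect_not_split min_imperfect_no_domination
    by unfold_locales auto
  have "in_triangle v" using v unfolding in_triangle_def by blast
  then show False
    using house_free_contradiction hammer_free_contradiction assms(4) by blast
qed

lemma weight_divisible_bull_free:
  assumes "finite U" "\<not> bull_in U" "\<not> house_in U \<or> \<not> hammer_in U" "U \<noteq> {}" "\<forall>v\<in>U. 0 < w v"
    and triangle_free:
      "\<And>D w. \<lbrakk>D \<subseteq> U; D \<noteq> {}; \<not> triangle_in D; \<forall>v\<in>D. 0 < w v\<rbrakk> \<Longrightarrow> weight_divisible w D"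
  shows "weight_divisible w U"
  using assms
proof (induction "card U" arbitrary: U w rule: less_induct)
  case less
  show ?case
  proof (cases "triangle_in U")
    case False
    then show ?thesis using less.prems by blast
  next
    case True
    show ?thesis
    proof (rule weight_divisible_with_triangle[OF less.prems(1,5,2,3) True])
      fix D and w :: "'a \<Rightarrow> nat" assume D: "D \<subset> U" "D \<noteq> {}" "\<forall>v\<in>D. 0 < w v"
      have "card D < card U" "finite D"
        using D(1) less.prems(1) psubset_card_mono finite_subset by blast+
      moreover have "\<not> bull_in D"
        using less.prems(2) D(1) unfolding bull_in_def by blast
      moreover have "\<not> house_in D \<or> \<not> hammer_in D"
        using less.prems(3) D(1) unfolding house_in_def hammer_in_def by blast
      ultimately show "weight_divisible w D"
        using less.hyps[of D w] D less.prems(6) by blast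
    qed
  qed
qed

section \<open>Chromatic number and clique number\<close>

lemma card_clique_le_colors:
  assumes "colorable k U" "finite U" "K \<subseteq> U" "is_clique K"
  shows "card K \<le> k"
proof -
  obtain c :: "'a \<Rightarrow> nat" where c: "\<forall>v\<in>U. c v < k" "\<forall>u\<in>U. \<forall>v\<in>U. adj u v \<longrightarrow> c u \<noteq> c v"
    using assms(1) unfolding colorable_def by blast
  have "inj_on c K" using c(2) assms(3,4) unfolding inj_on_def is_clique_def by blast
  moreover have "c ` K \<subseteq> {..<k}" using c(1) assms(3) by auto
  ultimately have "card K \<le> card {..<k}" by (intro card_inj_on_le) auto
  then show ?thesis by simp
qed

lemma colorable_card:
  assumes "finite U"
  shows "colorable (card U) U"
proof -
  obtain c where "bij_betw c U {0..<card U}" using assms ex_bij_betw_finite_nat by blast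
  then have "inj_on c U" "c ` U = {0..<card U}" by (auto simp: bij_betw_def)
  then have "\<forall>v\<in>U. c v < card U" "\<forall>u\<in>U. \<forall>v\<in>U. adj u v \<longrightarrow> c u \<noteq> c v"
    by (auto dest: inj_onD)
  then show ?thesis unfolding colorable_def by blast
qed

text \<open>Cliques bound the number of colours from below, so only colourability with
  \<open>omega U\<close> colours is at stake; \<open>colorable_card\<close> makes the least value
  attained.\<close>

lemma Least_colorable_eq_omega:
  assumes "finite U"
  shows "(LEAST k. colorable k U) = omega U \<longleftrightarrow> colorable (omega U) U"
proof
  assume "(LEAST k. colorable k U) = omega U"
  then show "colorable (omega U) U" using LeastI[of "\<lambda>k. colorable k U", OF colorable_card[OF assms]] by simp
next
  assume "colorable (omega U) U"
  then show "(LEAST k. colorable k U) = omega U"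
  proof (rule Least_equality)
    fix k assume "colorable k U"
    then show "omega U \<le> k" using omega_attained[OF assms] card_clique_le_colors assms by metis
  qed
qed

end

section \<open>Transfer to pair graphs\<close>

sublocale pair_graph \<subseteq> sg: simple_graph "\<lambda>u v. (u, v) \<in> parcs G"
proof
  fix u v assume "(u, v) \<in> parcs G"
  then show "(v, u) \<in> parcs G" using graph_symmetric by simp
next
  fix u show "(u, u) \<notin> parcs G" using pair_no_loops by fastforce
qed

context pair_graph
begin

lemma arcs_ends_induce: "arcs_ends (with_proj G \<restriction> U) = {(u, v). (u, v) \<in> parcs G \<and> u \<in> U \<and> v \<in> U}"
  by (auto simp: arcs_ends_conv image_iff)

lemma clique_induce: "clique (with_proj G \<restriction> U) K \<longleftrightarrow> K \<subseteq> U \<and> sg.is_clique K"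
  unfolding clique_def sg.is_clique_def arcs_ends_induce by auto

lemma clique_number_induce: "clique_number (with_proj G \<restriction> U) = sg.omega U"
  by (simp add: clique_number_def sg.omega_def clique_induce)

lemma weighted_clique_number_induce:
  "weighted_clique_number w (with_proj G \<restriction> U) = sg.clique_weight w U"
  by (simp add: weighted_clique_number_def sg.clique_weight_def clique_induce)

lemma chromatic_number_induce: "chromatic_number (with_proj G \<restriction> U) = (LEAST k. sg.colorable k U)"
proof -
  have "proper_coloring (with_proj G \<restriction> U) k c \<longleftrightarrow>
      (\<forall>v\<in>U. c v < k) \<and> (\<forall>u\<in>U. \<forall>v\<in>U. (u, v) \<in> parcs G \<longrightarrow> c u \<noteq> c v)" for k c
    unfolding proper_coloring_def arcs_ends_induce by auto
  then show ?thesis by (simp add: chromatic_number_def sg.colorable_def)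
qed

lemma induce_induce: "D \<subseteq> U \<Longrightarrow> (with_proj G \<restriction> U) \<restriction> D = with_proj G \<restriction> D"
  by (auto simp: induce_subgraph_def)

text \<open>This turns quantification over induced subgraphs into quantification over vertex
  sets.\<close>

lemma induced_subgraph_induce:
  assumes "U \<subseteq> pverts G"
  shows "induced_subgraph H (with_proj G \<restriction> U) \<longleftrightarrow> (\<exists>D\<subseteq>U. H = with_proj G \<restriction> D)"
proof
  assume H: "induced_subgraph H (with_proj G \<restriction> U)"
  then have D: "verts H \<subseteq> U" by (auto simp: induced_subgraph_def subgraph_def)
  have "H = (with_proj G \<restriction> U) \<restriction> verts H"
    using H by (intro pre_digraph.equality)
      (auto simp: induced_subgraph_def subgraph_def compatible_def)
  then show "\<exists>D\<subseteq>U. H = with_proj G \<restriction> D" using D induce_induce by metis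
next
  assume "\<exists>D\<subseteq>U. H = with_proj G \<restriction> D"
  then obtain D where D: "D \<subseteq> U" "H = (with_proj G \<restriction> U) \<restriction> D" using induce_induce by metis
  interpret GU: wf_digraph "with_proj G \<restriction> U" by unfold_locales auto
  show "induced_subgraph H (with_proj G \<restriction> U)"
    unfolding D(2) using D(1) by (intro GU.induced_induce) simp
qed

lemma perfect_induce:
  assumes "U \<subseteq> pverts G"
  shows "perfect (with_proj G \<restriction> U) \<longleftrightarrow> sg.perfect_on U"
proof -
  have "chromatic_number (with_proj G \<restriction> D) = clique_number (with_proj G \<restriction> D) \<longleftrightarrow>
      sg.colorable (sg.omega D) D" if "D \<subseteq> U" for D
  proof -
    have "finite D" using finite_subset[OF subset_trans[OF that assms] pair_finite_verts] .
    then show ?thesis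
      unfolding chromatic_number_induce clique_number_induce by (rule sg.Least_colorable_eq_omega)
  qed
  moreover have "perfect (with_proj G \<restriction> U) \<longleftrightarrow>
      (\<forall>D\<subseteq>U. chromatic_number (with_proj G \<restriction> D) = clique_number (with_proj G \<restriction> D))"
    unfolding perfect_def induced_subgraph_induce[OF assms] by metis
  ultimately show ?thesis unfolding sg.perfect_on_def by simp
qed

lemma weight_divisible_induce:
  assumes "D \<subseteq> pverts G"
  shows "(\<exists>P W. P \<union> W = verts (with_proj G \<restriction> D) \<and> P \<inter> W = {} \<and> perfect ((with_proj G \<restriction> D) \<restriction> P) \<and>
      weighted_clique_number w ((with_proj G \<restriction> D) \<restriction> W) < weighted_clique_number w (with_proj G \<restriction> D)) \<longleftrightarrow>
    sg.weight_divisible w D"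
proof -
  have "P \<union> W = D \<and> P \<inter> W = {} \<and> perfect ((with_proj G \<restriction> D) \<restriction> P) \<and>
      weighted_clique_number w ((with_proj G \<restriction> D) \<restriction> W) < weighted_clique_number w (with_proj G \<restriction> D) \<longleftrightarrow>
    P \<union> W = D \<and> P \<inter> W = {} \<and> sg.perfect_on P \<and> sg.clique_weight w W < sg.clique_weight w D" for P W
  proof (cases "P \<union> W = D")
    case True
    then have "P \<subseteq> D" "W \<subseteq> D" "P \<subseteq> pverts G" using assms by auto
    then show ?thesis by (simp add: induce_induce perfect_induce weighted_clique_number_induce)
  next
    case False
    then show ?thesis by blast
  qed
  then show ?thesis unfolding sg.weight_divisible_def induce_subgraph_verts by simp
qed

lemma perfectly_weight_divisible_induce:
  assumes "U \<subseteq> pverts G"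
  shows "perfectly_weight_divisible (with_proj G \<restriction> U) \<longleftrightarrow>
    (\<forall>w. (\<forall>v\<in>U. 0 < w v) \<longrightarrow> (\<forall>D\<subseteq>U. D \<noteq> {} \<longrightarrow> sg.weight_divisible w D))"
proof -
  have "(\<forall>H. induced_subgraph H (with_proj G \<restriction> U) \<and> verts H \<noteq> {} \<longrightarrow> Q H) \<longleftrightarrow>
      (\<forall>D\<subseteq>U. D \<noteq> {} \<longrightarrow> Q (with_proj G \<restriction> D))" for Q
    unfolding induced_subgraph_induce[OF assms] by (metis induce_subgraph_verts)
  then show ?thesis
    unfolding perfectly_weight_divisible_def
    using weight_divisible_induce[OF subset_trans[OF _ assms]] by simp
qed

lemma induce_pverts: "with_proj G \<restriction> pverts G = with_proj G"
  by (rule pre_digraph.equality) (auto dest: in_arcsD1 in_arcsD2)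

lemma perfectly_weight_divisible_iff:
  "perfectly_weight_divisible (with_proj G) \<longleftrightarrow>
    (\<forall>w. (\<forall>v\<in>pverts G. 0 < w v) \<longrightarrow> (\<forall>D\<subseteq>pverts G. D \<noteq> {} \<longrightarrow> sg.weight_divisible w D))"
  using perfectly_weight_divisible_induce[of "pverts G"] by (simp add: induce_pverts)

text \<open>An injective vertex map determines the isomorphism record: arcs are pairs and are mapped
  componentwise, while head and tail remain projections.\<close>

lemma contains_inducedI:
  assumes F: "pair_wf_digraph F" and f: "inj_on f (pverts F)" "f ` pverts F \<subseteq> pverts G"
    and iff: "\<And>u v. \<lbrakk>u \<in> pverts F; v \<in> pverts F\<rbrakk> \<Longrightarrow> (u, v) \<in> parcs F \<longleftrightarrow> (f u, f v) \<in> parcs G"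
  shows "contains_induced (with_proj G) (with_proj F)"
proof -
  interpret F: pair_wf_digraph F by (rule F)
  let ?S = "with_proj G \<restriction> (f ` pverts F)"
  let ?h = "\<lparr>iso_verts = f, iso_arcs = map_prod f f, iso_head = snd, iso_tail = fst\<rparr>"
  have "parcs F \<subseteq> pverts F \<times> pverts F" using F.arc_fst_in_verts F.arc_snd_in_verts by fastforce
  then have inj: "inj_on (map_prod f f) (parcs F)"
    by (rule inj_on_subset[OF map_prod_inj_on[OF f(1) f(1)]])
  have "pre_digraph.digraph_isomorphism (with_proj F) ?h"
    unfolding pre_digraph.digraph_isomorphism_def using f(1) inj F.wf_digraph_axioms by auto
  moreover have "arcs ?S = map_prod f f ` parcs F"
  proof (intro equalityI subsetI)
    fix e assume "e \<in> arcs ?S"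
    then obtain u v where "e = (f u, f v)" "u \<in> pverts F" "v \<in> pverts F" "(f u, f v) \<in> parcs G"
      by (cases e) auto
    then show "e \<in> map_prod f f ` parcs F" using iff by (auto intro!: image_eqI[of _ _ "(u, v)"])
  next
    fix e assume "e \<in> map_prod f f ` parcs F"
    then obtain u v where uv: "e = (f u, f v)" "(u, v) \<in> parcs F" by auto
    then have "u \<in> pverts F" "v \<in> pverts F" using F.in_arcsD1 F.in_arcsD2 by blast+
    then show "e \<in> arcs ?S" using uv iff by auto
  qed
  then have "?S = app_iso ?h (with_proj F)"
    by (intro pre_digraph.equality) auto
  ultimately have "digraph_iso (with_proj F) ?S" unfolding digraph_iso_def by blast
  moreover have "induced_subgraph ?S (with_proj G)"
    using induced_subgraph_induce[of "pverts G"] f(2) induce_pverts by auto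
  ultimately show ?thesis unfolding contains_induced_def by blast
qed

lemma contains_inducedD:
  assumes F: "pair_wf_digraph F" and "contains_induced (with_proj G) (with_proj F)"
  shows "\<exists>f. \<forall>u v. (u, v) \<in> parcs F \<longrightarrow> (f u, f v) \<in> parcs G"
proof -
  interpret F: pair_wf_digraph F by (rule F)
  obtain S h where S: "induced_subgraph S (with_proj G)" "pre_digraph.digraph_isomorphism (with_proj F) h"
    "S = app_iso h (with_proj F)"
    using assms(2) unfolding contains_induced_def digraph_iso_def by blast
  have sub: "arcs S \<subseteq> parcs G" "tail S = fst" "head S = snd"
    using S(1) by (auto simp: induced_subgraph_def subgraph_def compatible_def)
  show ?thesis
  proof (intro exI[of _ "iso_verts h"] allI impI)
    fix u v assume uv: "(u, v) \<in> parcs F"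
    have "iso_arcs h (u, v) \<in> parcs G" using sub(1) S(3) uv by auto
    moreover have "fst (iso_arcs h (u, v)) = iso_verts h u" "snd (iso_arcs h (u, v)) = iso_verts h v"
      using pre_digraph.iso_verts_tail[OF S(2), of "(u, v)"] pre_digraph.iso_verts_head[OF S(2), of "(u, v)"]
        S(3) sub(2,3) uv by simp_all
    ultimately show "(iso_verts h u, iso_verts h v) \<in> parcs G" by (metis prod.collapse)
  qed
qed

end

section \<open>The concrete patterns\<close>

lemma lessThan_3: "{..<3::nat} = {0, 1, 2}" and lessThan_5: "{..<5::nat} = {0, 1, 2, 3, 4}"
  by auto

lemma house_arc_iff:
  "(u, v) \<in> parcs house \<longleftrightarrow> u < 5 \<and> v < 5 \<and> u \<noteq> v \<and> v \<noteq> Suc u \<and> u \<noteq> Suc v"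
  by (auto simp: house_def complement_graph_def path_graph_def graph_of_edges_def)

lemma pverts_patterns:
  "pverts bull = {..<5}" "pverts house = {..<5}" "pverts hammer = {..<5}" "pverts triangle_graph = {..<3}"
  by (auto simp: bull_def house_def hammer_def triangle_graph_def complement_graph_def path_graph_def
      graph_of_edges_def)

lemma wf_patterns:
  "pair_wf_digraph bull" "pair_wf_digraph house" "pair_wf_digraph hammer" "pair_wf_digraph triangle_graph"
  unfolding pair_wf_digraph_def
  by (auto simp: pverts_patterns house_arc_iff bull_def hammer_def triangle_graph_def graph_of_edges_def)

text \<open>The house is the complement of the path, so its triangle consists of the pairwise
  non-consecutive indices 0, 2, 4.\<close>

lemma triangle_in_patterns:
  "(0, 1) \<in> parcs bull" "(1, 2) \<in> parcs bull" "(0, 2) \<in> parcs bull"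
  "(0, 2) \<in> parcs house" "(2, 4) \<in> parcs house" "(0, 4) \<in> parcs house"
  "(0, 1) \<in> parcs hammer" "(1, 2) \<in> parcs hammer" "(0, 2) \<in> parcs hammer"
  "(0, 1) \<in> parcs triangle_graph" "(1, 2) \<in> parcs triangle_graph" "(0, 2) \<in> parcs triangle_graph"
  by (auto simp: house_arc_iff bull_def hammer_def triangle_graph_def graph_of_edges_def)

context pair_graph
begin

lemma contains_bull:
  assumes "sg.bull_in (pverts G)"
  shows "contains_induced (with_proj G) (with_proj bull)"
proof -
  obtain a b c d e where V: "a \<in> pverts G" "b \<in> pverts G" "c \<in> pverts G" "d \<in> pverts G" "e \<in> pverts G"
    and E: "(a, b) \<in> parcs G" "(b, c) \<in> parcs G" "(a, c) \<in> parcs G" "(a, d) \<in> parcs G" "(b, e) \<in> parcs G"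
    "(b, d) \<notin> parcs G" "(c, d) \<notin> parcs G" "(a, e) \<notin> parcs G" "(c, e) \<notin> parcs G" "(d, e) \<notin> parcs G"
    using assms unfolding sg.bull_in_def by blast
  have E': "(b, a) \<in> parcs G" "(c, b) \<in> parcs G" "(c, a) \<in> parcs G" "(d, a) \<in> parcs G" "(e, b) \<in> parcs G"
    "(d, b) \<notin> parcs G" "(d, c) \<notin> parcs G" "(e, a) \<notin> parcs G" "(e, c) \<notin> parcs G" "(e, d) \<notin> parcs G"
    using E sg.adj_sym by blast+
  have "distinct [a, b, c, d, e]" using E E' by auto
  then have "inj_on (nth [a, b, c, d, e]) {..<5}" by (intro inj_on_nth) auto
  moreover have "\<forall>u\<in>{..<5}. \<forall>v\<in>{..<5}. (u, v) \<in> parcs bull \<longleftrightarrow> ([a, b, c, d, e] ! u, [a, b, c, d, e] ! v) \<in> parcs G"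
    using E E' by (simp add: lessThan_5 bull_def graph_of_edges_def)
  moreover have "nth [a, b, c, d, e] ` {..<5} \<subseteq> pverts G"
    using V by (simp add: lessThan_5)
  ultimately show ?thesis
    by (intro contains_inducedI[OF wf_patterns(1), of "nth [a, b, c, d, e]"]) (simp_all add: pverts_patterns)
qed

lemma contains_house:
  assumes "sg.house_in (pverts G)"
  shows "contains_induced (with_proj G) (with_proj house)"
proof -
  obtain r a b c d where V: "r \<in> pverts G" "a \<in> pverts G" "b \<in> pverts G" "c \<in> pverts G" "d \<in> pverts G"
    and E: "(r, a) \<in> parcs G" "(r, b) \<in> parcs G" "(a, b) \<in> parcs G" "(a, c) \<in> parcs G" "(b, d) \<in> parcs G"
    "(c, d) \<in> parcs G" "(r, c) \<notin> parcs G" "(r, d) \<notin> parcs G" "(a, d) \<notin> parcs G" "(b, c) \<notin> parcs G"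
    using assms unfolding sg.house_in_def by blast
  have E': "(a, r) \<in> parcs G" "(b, r) \<in> parcs G" "(b, a) \<in> parcs G" "(c, a) \<in> parcs G" "(d, b) \<in> parcs G"
    "(d, c) \<in> parcs G" "(c, r) \<notin> parcs G" "(d, r) \<notin> parcs G" "(d, a) \<notin> parcs G" "(c, b) \<notin> parcs G"
    using E sg.adj_sym by blast+
  \<comment> \<open>This order runs along the complementary path: consecutive vertices are exactly
    the non-adjacent pairs.\<close>
  have "distinct [a, d, r, c, b]" using E E' by auto
  then have "inj_on (nth [a, d, r, c, b]) {..<5}" by (intro inj_on_nth) auto
  moreover have "\<forall>u\<in>{..<5}. \<forall>v\<in>{..<5}. (u, v) \<in> parcs house \<longleftrightarrow> ([a, d, r, c, b] ! u, [a, d, r, c, b] ! v) \<in> parcs G"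
    using E E' by (simp add: lessThan_5 house_arc_iff)
  moreover have "nth [a, d, r, c, b] ` {..<5} \<subseteq> pverts G"
    using V by (simp add: lessThan_5)
  ultimately show ?thesis
    by (intro contains_inducedI[OF wf_patterns(2), of "nth [a, d, r, c, b]"]) (simp_all add: pverts_patterns)
qed

lemma contains_hammer:
  assumes "sg.hammer_in (pverts G)"
  shows "contains_induced (with_proj G) (with_proj hammer)"
proof -
  obtain a b c d e where V: "a \<in> pverts G" "b \<in> pverts G" "c \<in> pverts G" "d \<in> pverts G" "e \<in> pverts G"
    and E: "(a, b) \<in> parcs G" "(b, c) \<in> parcs G" "(a, c) \<in> parcs G" "(c, d) \<in> parcs G" "(d, e) \<in> parcs G"
    "(a, d) \<notin> parcs G" "(b, d) \<notin> parcs G" "(a, e) \<notin> parcs G" "(b, e) \<notin> parcs G" "(c, e) \<notin> parcs G"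
    using assms unfolding sg.hammer_in_def by blast
  have E': "(b, a) \<in> parcs G" "(c, b) \<in> parcs G" "(c, a) \<in> parcs G" "(d, c) \<in> parcs G" "(e, d) \<in> parcs G"
    "(d, a) \<notin> parcs G" "(d, b) \<notin> parcs G" "(e, a) \<notin> parcs G" "(e, b) \<notin> parcs G" "(e, c) \<notin> parcs G"
    using E sg.adj_sym by blast+
  have "distinct [a, b, c, d, e]" using E E' by auto
  then have "inj_on (nth [a, b, c, d, e]) {..<5}" by (intro inj_on_nth) auto
  moreover have "\<forall>u\<in>{..<5}. \<forall>v\<in>{..<5}. (u, v) \<in> parcs hammer \<longleftrightarrow> ([a, b, c, d, e] ! u, [a, b, c, d, e] ! v) \<in> parcs G"
    using E E' by (simp add: lessThan_5 hammer_def graph_of_edges_def)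
  moreover have "nth [a, b, c, d, e] ` {..<5} \<subseteq> pverts G"
    using V by (simp add: lessThan_5)
  ultimately show ?thesis
    by (intro contains_inducedI[OF wf_patterns(3), of "nth [a, b, c, d, e]"]) (simp_all add: pverts_patterns)
qed

lemma contains_triangle:
  assumes "sg.triangle_in (pverts G)"
  shows "contains_induced (with_proj G) (with_proj triangle_graph)"
proof -
  obtain a b c where V: "a \<in> pverts G" "b \<in> pverts G" "c \<in> pverts G"
    and E: "(a, b) \<in> parcs G" "(b, c) \<in> parcs G" "(a, c) \<in> parcs G"
    using assms unfolding sg.triangle_in_def by blast
  have E': "(b, a) \<in> parcs G" "(c, b) \<in> parcs G" "(c, a) \<in> parcs G"
    using E sg.adj_sym by blast+
  have "distinct [a, b, c]" using E by auto
  then have "inj_on (nth [a, b, c]) {..<3}" by (intro inj_on_nth) auto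
  moreover have "\<forall>u\<in>{..<3}. \<forall>v\<in>{..<3}. (u, v) \<in> parcs triangle_graph \<longleftrightarrow> ([a, b, c] ! u, [a, b, c] ! v) \<in> parcs G"
    using E E' by (simp add: lessThan_3 triangle_graph_def graph_of_edges_def)
  moreover have "nth [a, b, c] ` {..<3} \<subseteq> pverts G"
    using V by (simp add: lessThan_3)
  ultimately show ?thesis
    by (intro contains_inducedI[OF wf_patterns(4), of "nth [a, b, c]"]) (simp_all add: pverts_patterns)
qed

lemma triangle_of_contains_induced:
  assumes "pair_wf_digraph F" "contains_induced (with_proj G) (with_proj F)"
    and "(i, j) \<in> parcs F" "(j, k) \<in> parcs F" "(i, k) \<in> parcs F"
  shows "sg.triangle_in (pverts G)"
proof -
  obtain f where f: "\<forall>u v. (u, v) \<in> parcs F \<longrightarrow> (f u, f v) \<in> parcs G"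
    using contains_inducedD[OF assms(1,2)] ..
  have "(f i, f j) \<in> parcs G" "(f j, f k) \<in> parcs G" "(f i, f k) \<in> parcs G"
    using f assms(3-5) by simp_all
  moreover have "f i \<in> pverts G" "f j \<in> pverts G" "f k \<in> pverts G"
    using in_arcsD1[OF calculation(1)] in_arcsD1[OF calculation(2)] in_arcsD2[OF calculation(2)] by simp_all
  ultimately show ?thesis unfolding sg.triangle_in_def by blast
qed

lemma triangle_free_iff:
  "G \<in> free_graphs {triangle_graph} \<longleftrightarrow>
    \<not> (\<exists>a b c. (a, b) \<in> parcs G \<and> (b, c) \<in> parcs G \<and> (a, c) \<in> parcs G)"
proof -
  have "contains_induced (with_proj G) (with_proj triangle_graph) \<longleftrightarrow> sg.triangle_in (pverts G)"
    using contains_triangle triangle_of_contains_induced[OF wf_patterns(4) _ triangle_in_patterns(10-12)]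
    by blast
  moreover have "sg.triangle_in (pverts G) \<longleftrightarrow>
      (\<exists>a b c. (a, b) \<in> parcs G \<and> (b, c) \<in> parcs G \<and> (a, c) \<in> parcs G)"
    unfolding sg.triangle_in_def using in_arcsD1 in_arcsD2 by meson
  ultimately show ?thesis using pair_graph_axioms by (simp add: free_graphs_def)
qed

end

theorem theorem8:
  fixes H :: "nat pair_pre_digraph"
    and \<C> \<G> \<H> :: "'a pair_pre_digraph set"
  assumes "H \<in> {house, hammer}"
    and "\<C> = free_graphs {bull, H}"
    and "hereditary \<G>"
    and "\<H> = free_graphs {triangle_graph}"
  shows "(\<forall>G \<in> \<G> \<inter> \<C>. perfectly_weight_divisible (with_proj G)) \<longleftrightarrow>
         (\<forall>G \<in> \<G> \<inter> \<H>. perfectly_weight_divisible (with_proj G))"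
proof
  \<comment> \<open>Each of the bull, the house and the hammer contains a triangle.\<close>
  have "\<H> \<subseteq> \<C>"
  proof
    fix G assume G: "G \<in> \<H>"
    then interpret pair_graph G by (simp add: assms(4) free_graphs_def)
    have tf: "\<not> sg.triangle_in (pverts G)"
      using G triangle_free_iff assms(4) unfolding sg.triangle_in_def by simp
    have "\<not> contains_induced (with_proj G) (with_proj bull)"
      using triangle_of_contains_induced[OF wf_patterns(1) _ triangle_in_patterns(1-3)] tf by blast
    moreover have "\<not> contains_induced (with_proj G) (with_proj house)"
      using triangle_of_contains_induced[OF wf_patterns(2) _ triangle_in_patterns(4-6)] tf by blast
    moreover have "\<not> contains_induced (with_proj G) (with_proj hammer)"
      using triangle_of_contains_induced[OF wf_patterns(3) _ triangle_in_patterns(7-9)] tf by blast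
    ultimately show "G \<in> \<C>"
      using assms(1,2) pair_graph_axioms by (auto simp: free_graphs_def)
  qed
  then show "\<forall>G \<in> \<G> \<inter> \<C>. perfectly_weight_divisible (with_proj G) \<Longrightarrow>
      \<forall>G \<in> \<G> \<inter> \<H>. perfectly_weight_divisible (with_proj G)" by blast
next
  assume tri: "\<forall>G \<in> \<G> \<inter> \<H>. perfectly_weight_divisible (with_proj G)"
  show "\<forall>G \<in> \<G> \<inter> \<C>. perfectly_weight_divisible (with_proj G)"
  proof
    fix G assume G: "G \<in> \<G> \<inter> \<C>"
    then interpret pair_graph G by (simp add: assms(2) free_graphs_def)
    have nb: "\<not> sg.bull_in (pverts G)"
      using G contains_bull assms(2) by (auto simp: free_graphs_def)
    have nh: "\<not> sg.house_in (pverts G) \<or> \<not> sg.hammer_in (pverts G)"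
      using G contains_house contains_hammer assms(1,2) by (auto simp: free_graphs_def)
    have tf: "sg.weight_divisible w D"
      if D: "D \<subseteq> pverts G" "D \<noteq> {}" "\<not> sg.triangle_in D" "\<forall>v\<in>D. 0 < w v" for D w
    proof -
      \<comment> \<open>\<open>hereditary\<close> speaks of \<open>pair_pre_digraph\<close> values,
        so the restriction to \<open>D\<close> is rebuilt in that type and identified with it
        through \<open>with_proj\<close>.\<close>
      define G' where "G' = \<lparr>pverts = D, parcs = {e \<in> parcs G. fst e \<in> D \<and> snd e \<in> D}\<rparr>"
      have G'_eq: "with_proj G' = with_proj G \<restriction> D"
        by (simp add: G'_def with_proj_def induce_subgraph_def)
      have "induced_subgraph (with_proj G \<restriction> D) (with_proj G \<restriction> pverts G)"
        using induced_subgraph_induce[OF order_refl] D(1) by metis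
      then have ind: "induced_subgraph (with_proj G') (with_proj G)"
        by (simp only: G'_eq induce_pverts)
      have "G \<in> \<G>" using G by simp
      then have "G' \<in> \<G>" using assms(3)[unfolded hereditary_def] ind by metis
      then have "pair_graph G'" using assms(3)[unfolded hereditary_def] by metis
      moreover have "\<not> (\<exists>a b c. (a, b) \<in> parcs G' \<and> (b, c) \<in> parcs G' \<and> (a, c) \<in> parcs G')"
      proof
        assume "\<exists>a b c. (a, b) \<in> parcs G' \<and> (b, c) \<in> parcs G' \<and> (a, c) \<in> parcs G'"
        then obtain a b c where "(a, b) \<in> parcs G'" "(b, c) \<in> parcs G'" "(a, c) \<in> parcs G'" by metis
        then have "a \<in> D" "b \<in> D" "c \<in> D" "(a, b) \<in> parcs G" "(b, c) \<in> parcs G" "(a, c) \<in> parcs G"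
          by (simp_all add: G'_def)
        then show False using D(3) unfolding sg.triangle_in_def by metis
      qed
      ultimately have "G' \<in> \<H>" using pair_graph.triangle_free_iff assms(4) by metis
      then have "perfectly_weight_divisible (with_proj G \<restriction> D)" using tri \<open>G' \<in> \<G>\<close> G'_eq by (metis IntI)
      then show ?thesis
        using perfectly_weight_divisible_induce[OF D(1)] D(2,4) by blast
    qed
    show "perfectly_weight_divisible (with_proj G)"
      unfolding perfectly_weight_divisible_iff
    proof (intro allI impI)
      fix w :: "'a \<Rightarrow> nat" and D assume w: "\<forall>v\<in>pverts G. 0 < w v" and D: "D \<subseteq> pverts G" "D \<noteq> {}"
      show "sg.weight_divisible w D"
      proof (rule sg.weight_divisible_bull_free)
        show "finite D" using D(1) pair_finite_verts by (rule finite_subset)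
        show "\<not> sg.bull_in D" using nb D(1) unfolding sg.bull_in_def by blast
        show "\<not> sg.house_in D \<or> \<not> sg.hammer_in D"
          using nh D(1) unfolding sg.house_in_def sg.hammer_in_def by blast
        show "\<forall>v\<in>D. 0 < w v" using w D(1) by blast
        show "sg.weight_divisible w' D'"
          if "D' \<subseteq> D" "D' \<noteq> {}" "\<not> sg.triangle_in D'" "\<forall>v\<in>D'. 0 < w' v" for D' w'
          using tf that D(1) by blast
      qed (rule D(2))
    qed
  qed
qed

end
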